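(* Let $q\in\mathcal C_{\mathcal B}$ be near $\underline q$ and assume the profile $W(z,q)$ is strongly transversal. Then for some $\rho_0>0$ $$D_s(q,\hat\zeta,\rho)=\rho\,\alpha(q,\zeta)D_m(q,\hat\zeta,\rho)+O(\rho^2),\qquad\zeta=\rho\hat\zeta,$$ where the error is uniform for $\hat\zeta\in\overline S^d_+$, $0<\rho\le\rho_0$, and $\alpha(q,\zeta)$ is $C^\infty$ and bounded away from zero for $\rho$ small.
   Context: Setting. $N,d\ge1$, $A_0=I$; $A_1,\dots,A_d$ are $C^\infty$ maps from a connected open set $\mathcal U^*\subset\mathbb R^N$ to $\mathbb R^{N\times N}$; $\mathcal U_\pm\subset\mathcal U^*$ are connected open sets such that for $u\in\mathcal U_+\cup\mathcal U_-$, $\xi\in\mathbb R^d\setminus\{0\}$ all eigenvalues of $\sum_{j=1}^d\xi_jA_j(u)$ are real. $\mathcal A_d(u,s,h)=A_d(u)-sA_0(u)-\sum_{j<d}h_jA_j(u)$. $\mathbb E_\pm(M)$ is the sum of generalized eigenspaces of $M$ for eigenvalues $\mu$ with $\pm\mathrm{Re}\,\mu>0$. Profile equation: $(1+|h|^2)w''=\mathcal A_d(w,s,h)w'$. Base profile. $\underline q=(\underline p_+,\underline p_-,0,0)$, $\underline p_\pm\in\mathcal U_\pm$, $A_d(\underline p_\pm)$ invertible; $\underline w$ is a nonconstant solution of $\underline w''=A_d(\underline w)\underline w'$ on $\mathbb R$ with limits $\underline p_\pm$ at $\pm\infty$. (Number of negative eigenvalues of $A_d(\underline p_+)$)+(number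 of positive eigenvalues of $A_d(\underline p_-)$)$=N+1-k$, $k\ge0$. Strong transversality. Let $G_d=(1+|h|^2)^{-1}\mathcal A_d$; fix smooth families of isomorphisms $\alpha_\pm(p_\pm,s,h;\cdot):\mathbb E_\mp(G_d(\underline p_\pm,0,0))\to\mathbb E_\mp(G_d(p_\pm,s,h))$, and let $\Pi_\mp$ be the spectral projection on $\mathbb E_\mp(G_d(p_\pm,s,h))$. There are $R,r>0$ such that for $(p_\pm,s,h)$ near $(\underline p_\pm,0,0)$, $a_\pm\in\mathbb E_\mp(G_d(\underline p_\pm,0,0))$, $|a_\pm|\le r$, the profile equation on $\pm z\ge0$ has a unique solution $\Phi_\pm(z,p_\pm,s,h,a_\pm)$ with limit $p_\pm$, $\Pi_\mp\partial_z\Phi_\pm(0)=\alpha_\pm(p_\pm,s,h;a_\pm)$, $\|\partial_z\Phi_\pm\|_{L^1},\|\partial_z\Phi_\pm\|_{L^\infty}\le R$; $\Phi_\pm$ is $C^\infty$ (same notation for its maximal extension in $z$). There are $\underline z\le0$, $\underline a$ with $\underline w(z)=\Phi_\pm(z\pm\underline z,\underline p_\pm,0,0,\underline a_\pm)$ on $\pm z\ge0$. Set $\phi_\pm(z,\cdot)=\Phi_\pm(z\pm\underline z,\cdot)$ and $$\widetilde\Psi(p,s,h,a)=\big(\phi_+-\phi_-,\partial_z\phi_+-\partial_z\phi_-,s+\phi_+\cdot\underline w_z(0)-\underline w(0)\cdot\underline w_z(0)\big)|_{z=0},\quad p=(p_+,p_-),\ a=(a_+,a_-).$$ $\mathcal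 C_{\mathcal B}$ is a $C^\infty$ manifold of dimension $N+d-k$ of points $q=(p,s,h)$ near $\underline q$, with profiles $W(z,q)=\phi_\pm(z,p_\pm,s,h,a_\pm(q))$ on $\pm z\ge0$, $a(q)$ smooth, $a(\underline q)=\underline a$, $\widetilde\Psi(q,a(q))=0$; $W(\cdot,\underline q)=\underline w$. $W(z,q)$ is strongly transversal if $\mathrm{rank}\,\nabla_a\widetilde\Psi=N+1-k$ and $\mathrm{rank}\,\nabla_{a,p}\widetilde\Psi=2N+1$ at $(q,a(q))$. Evans functions. $\overline S^d_+=\{\hat\zeta=(\hat\tau,\hat\gamma,\hat\eta)\in\mathbb R\times\mathbb R\times\mathbb R^{d-1}:|\hat\zeta|=1,\hat\gamma\ge0\}$; $\zeta=(\tau,\gamma,\eta)=\rho\hat\zeta$. With $W=W(z,q)$, $'=\partial_z$: $$\mathcal Lu=-(1+|h|^2)u''+\Big(\mathcal A_d(W,s,h)+2\sum_{j<d}h_ji\eta_j\Big)u'+(\partial_w\mathcal A_d(W,s,h)u)W'+(i\tau+\gamma)A_0(W)u+\sum_{j<d}i\eta_jA_j(W)u+|\eta|^2u,$$ $$\mathcal L_1=(i\tau+\gamma)A_0(W)W'+\sum_{j<d}i\eta_jA_j(W)W'+2\sum_{j<d}h_ji\eta_jW''+|\eta|^2W'.$$ For $\rho>0$, $E_\pm(q,\hat\zeta,\rho)\subset\mathbb C^{2N}$ is the $N$-dimensional space of $(u(0),u'(0))$ for bounded solutions of $\mathcal Lu=0$ on $\pm z\ge0$. For subspaces $E,F\subset\mathbb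 C^D$ with $\dim E+\dim F=D$, $\det(E,F)$ denotes the determinant formed by taking orthonormal bases in $E$ and $F$. Standard Evans function: $D_s(q,\hat\zeta,\rho)=\det(E_-\times E_+,\{(U,U):U\in\mathbb C^{2N}\})$. Modified Evans function for small $\rho$: there are $C^\infty$ functions $\mathbf R_\pm(z,q,\zeta)$ on $\pm z\ge0$, exponentially decaying as $z\to\pm\infty$, with $\mathcal L\mathbf R_\pm=\mathcal L_1$, $\underline w_z(0)\cdot\mathbf R_\pm(0,q,\zeta)=-(i\tau+\gamma+|\eta|^2)$, $\mathbf R_\pm(z,q,0)=0$; write $\mathbf R_\pm=\rho\check{\mathbf R}_\pm(z,q,\hat\zeta,\rho)$, where moreover $\mathbf R_\pm$ is chosen so that $\check{\mathbf R}_\pm(z,q,\hat\zeta,0)$ is linear in $(i\hat\tau+\hat\gamma,i\hat\eta)$, and set $\mathrm R^\pm=(\check{\mathbf R}_\pm,\partial_z\check{\mathbf R}_\pm)|_{z=0}$. Let $\mathbb G'(q,\hat\zeta,\rho)=\{(V^-,V^+,\phi)\in\mathbb C^{2N}\times\mathbb C^{2N}\times\mathbb C:V^+-V^-=\phi(\mathrm R^--\mathrm R^+),\ (\underline w_z(0),0)\cdot V^+=0\}$. Then $D_m(q,\hat\zeta,\rho)=\det(E_-\times E_+\times\mathbb C,\mathbb G')$ for $0<\rho\le\rho_0$. *)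

theory Defs
  imports "HOL-Analysis.Analysis"
begin

section \<open>Smooth maps and submanifolds\<close>

text \<open>\<open>Ck_on k U f\<close> is the class \<open>C\<^sup>k\<close> on an open set \<open>U\<close> of a finite-dimensional space.\<close>

primrec Ck_on ::
  "nat \<Rightarrow> 'a::real_normed_vector set \<Rightarrow> ('a \<Rightarrow> 'b::real_normed_vector) \<Rightarrow> bool" where
  "Ck_on 0 U f \<longleftrightarrow> continuous_on U f"
| "Ck_on (Suc k) U f \<longleftrightarrow> (\<forall>x\<in>U. f differentiable (at x)) \<and>
     (\<forall>v. Ck_on k U (\<lambda>x. frechet_derivative f (at x) v))"

text \<open>On an arbitrary set (half-lines, spheres, submanifolds, linear subspaces) smoothness means
  local extendability to a \<open>C\<^sup>\<infinity>\<close> map on an open set; for open sets this is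
  ordinary smoothness.\<close>

definition smooth_on ::
  "'a::real_normed_vector set \<Rightarrow> ('a \<Rightarrow> 'b::real_normed_vector) \<Rightarrow> bool" where
  "smooth_on S f \<longleftrightarrow> (\<forall>x\<in>S. \<exists>U g. open U \<and> x \<in> U \<and> (\<forall>k. Ck_on k U g) \<and> (\<forall>y\<in>U \<inter> S. g y = f y))"

definition smooth_submanifold :: "nat \<Rightarrow> 'a::euclidean_space set \<Rightarrow> bool" where
  "smooth_submanifold m M \<longleftrightarrow> (\<forall>x\<in>M. \<exists>U V (f :: 'a \<Rightarrow> 'a) g L.
     open U \<and> x \<in> U \<and> open V \<and> f ` U = V \<and> smooth_on U f \<and> smooth_on V g \<and>
     (\<forall>y\<in>U. g (f y) = y) \<and> subspace L \<and> dim L = m \<and> f ` (M \<inter> U) = V \<inter> L)"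


section \<open>Complexification and spectral subspaces\<close>

definition cvec :: "real^'n \<Rightarrow> complex^'n" where
  "cvec x = (\<chi> i. complex_of_real (x $ i))"

definition cmat :: "real^'n^'m \<Rightarrow> complex^'n^'m" where
  "cmat M = (\<chi> i j. complex_of_real (M $ i $ j))"

definition eigenvalue :: "real^'n^'n \<Rightarrow> complex \<Rightarrow> bool" where
  "eigenvalue M \<mu> \<longleftrightarrow> (\<exists>v. v \<noteq> 0 \<and> cmat M *v v = \<mu> *s v)"

definition gen_eigenspace :: "real^'n^'n \<Rightarrow> complex \<Rightarrow> (complex^'n) set" where
  "gen_eigenspace M \<mu> = {v. \<exists>k. ((\<lambda>x. cmat M *v x - \<mu> *s x) ^^ k) v = 0}"

text \<open>Real points of the sum of the generalized eigenspaces for the eigenvalues in \<open>\<Lambda>\<close>. For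
  \<open>\<Lambda>\<close> closed under conjugation, its real dimension is the number of eigenvalues in \<open>\<Lambda>\<close>,
  counted with algebraic multiplicity.\<close>

definition spectral_space :: "complex set \<Rightarrow> real^'n^'n \<Rightarrow> (real^'n) set" where
  "spectral_space \<Lambda> M =
     {x. cvec x \<in> vec.span (\<Union>\<mu>\<in>{\<mu>\<in>\<Lambda>. eigenvalue M \<mu>}. gen_eigenspace M \<mu>)}"

definition sign_part :: "real \<Rightarrow> complex set" where
  "sign_part \<epsilon> = {\<mu>. \<epsilon> * Re \<mu> > 0}"

text \<open>\<open>EE 1\<close> and \<open>EE (-1)\<close> are $\mathbb E_+$ and $\mathbb E_-$.\<close>

definition EE :: "real \<Rightarrow> real^'n^'n \<Rightarrow> (real^'n) set" where
  "EE \<epsilon> M = spectral_space (sign_part \<epsilon>) M"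

definition spectral_proj :: "real \<Rightarrow> real^'n^'n \<Rightarrow> real^'n \<Rightarrow> real^'n" where
  "spectral_proj \<epsilon> M x = (THE y. y \<in> EE \<epsilon> M \<and> x - y \<in> spectral_space (- sign_part \<epsilon>) M)"


section \<open>The system and its profile equation\<close>

text \<open>The space directions are indexed by \<open>'d\<close>, with \<open>dn :: 'd\<close> the normal direction (the index
  $d$). Since a type is never empty, $\mathbb R^{d-1}$ is rendered as the subspace of vectors
  \<open>h :: real^'d\<close> with \<open>h $ dn = 0\<close>, so that $d = 1$ is included.\<close>

datatype side = Plus | Minus

primrec sg :: "side \<Rightarrow> real" where
  "sg Plus = 1"
| "sg Minus = -1"

primrec side_of :: "side \<Rightarrow> 'a \<times> 'a \<Rightarrow> 'a" where
  "side_of Plus x = fst x"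
| "side_of Minus x = snd x"

primrec end_filter :: "side \<Rightarrow> real filter" where
  "end_filter Plus = at_top"
| "end_filter Minus = at_bot"

definition half_line :: "side \<Rightarrow> real set" where
  "half_line \<sigma> = {z. 0 \<le> sg \<sigma> * z}"

definition calA :: "('d::finite \<Rightarrow> real^'n \<Rightarrow> real^'n^'n) \<Rightarrow> 'd \<Rightarrow>
    real^'n \<Rightarrow> real \<Rightarrow> real^'d \<Rightarrow> real^'n^'n" where
  "calA A dn u s h = A dn u - s *\<^sub>R mat 1 - (\<Sum>j\<in>UNIV - {dn}. (h $ j) *\<^sub>R A j u)"

definition Gd :: "('d::finite \<Rightarrow> real^'n \<Rightarrow> real^'n^'n) \<Rightarrow> 'd \<Rightarrow>
    (real^'n) \<times> real \<times> (real^'d) \<Rightarrow> real^'n^'n" where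
  "Gd A dn = (\<lambda>(p, s, h). (1 / (1 + (norm h)\<^sup>2)) *\<^sub>R calA A dn p s h)"

definition hyperbolic_system :: "('d::finite \<Rightarrow> real^'n \<Rightarrow> real^'n^'n) \<Rightarrow>
    (real^'n) set \<Rightarrow> (side \<Rightarrow> (real^'n) set) \<Rightarrow> bool" where
  "hyperbolic_system A Ustar Us \<longleftrightarrow>
     open Ustar \<and> connected Ustar \<and> (\<forall>j. smooth_on Ustar (A j)) \<and>
     (\<forall>\<sigma>. open (Us \<sigma>) \<and> connected (Us \<sigma>) \<and> Us \<sigma> \<subseteq> Ustar) \<and>
     (\<forall>u\<in>Us Plus \<union> Us Minus. \<forall>\<xi>::real^'d. \<xi> \<noteq> 0 \<longrightarrow>
        (\<forall>\<mu>. eigenvalue (\<Sum>j\<in>UNIV. (\<xi> $ j) *\<^sub>R A j u) \<mu> \<longrightarrow> \<mu> \<in> \<real>))"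

definition profile_solution :: "('d::finite \<Rightarrow> real^'n \<Rightarrow> real^'n^'n) \<Rightarrow> 'd \<Rightarrow>
    (real^'n) set \<Rightarrow> real \<Rightarrow> real^'d \<Rightarrow> real set \<Rightarrow> (real \<Rightarrow> real^'n) \<Rightarrow> bool" where
  "profile_solution A dn Ustar s h J w \<longleftrightarrow> (\<exists>w1 w2. \<forall>z\<in>J. w z \<in> Ustar \<and>
     (w has_vector_derivative w1 z) (at z within J) \<and>
     (w1 has_vector_derivative w2 z) (at z within J) \<and>
     (1 + (norm h)\<^sup>2) *\<^sub>R w2 z = calA A dn (w z) s h *v w1 z)"

definition base_profile :: "('d::finite \<Rightarrow> real^'n \<Rightarrow> real^'n^'n) \<Rightarrow> 'd \<Rightarrow> (real^'n) set \<Rightarrow>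
    (side \<Rightarrow> (real^'n) set) \<Rightarrow> (side \<Rightarrow> real^'n) \<Rightarrow> (real \<Rightarrow> real^'n) \<Rightarrow> nat \<Rightarrow> bool" where
  "base_profile A dn Ustar Us pb wb k \<longleftrightarrow>
     (\<forall>\<sigma>. pb \<sigma> \<in> Us \<sigma> \<and> invertible (A dn (pb \<sigma>)) \<and> (wb \<longlongrightarrow> pb \<sigma>) (end_filter \<sigma>)) \<and>
     profile_solution A dn Ustar 0 0 UNIV wb \<and> \<not> (\<exists>c. \<forall>z. wb z = c) \<and>
     dim (EE (-1) (A dn (pb Plus))) + dim (EE 1 (A dn (pb Minus))) + k = CARD('n) + 1"


section \<open>Half-line profiles and the matching map\<close>

definition param_dom :: "'d \<Rightarrow> (side \<Rightarrow> (real^'n) set) \<Rightarrow> (side \<Rightarrow> real^'n) \<Rightarrow> real \<Rightarrow>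
    side \<Rightarrow> ((real^'n) \<times> real \<times> (real^'d::finite)) set" where
  "param_dom dn Us pb \<delta> \<sigma> =
     {(p, s, h). p \<in> Us \<sigma> \<and> h $ dn = 0 \<and> dist (p, s, h) (pb \<sigma>, 0, 0) < \<delta>}"

definition E_base :: "('d::finite \<Rightarrow> real^'n \<Rightarrow> real^'n^'n) \<Rightarrow> 'd \<Rightarrow> (side \<Rightarrow> real^'n) \<Rightarrow>
    side \<Rightarrow> (real^'n) set" where
  "E_base A dn pb \<sigma> = EE (- sg \<sigma>) (Gd A dn (pb \<sigma>, 0, 0))"

definition amp_dom :: "('d::finite \<Rightarrow> real^'n \<Rightarrow> real^'n^'n) \<Rightarrow> 'd \<Rightarrow> (side \<Rightarrow> real^'n) \<Rightarrow> real \<Rightarrow>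
    side \<Rightarrow> (real^'n) set" where
  "amp_dom A dn pb r \<sigma> = {a \<in> E_base A dn pb \<sigma>. norm a \<le> r}"

definition spectral_isos :: "('d::finite \<Rightarrow> real^'n \<Rightarrow> real^'n^'n) \<Rightarrow> 'd \<Rightarrow>
    (side \<Rightarrow> (real^'n) set) \<Rightarrow> (side \<Rightarrow> real^'n) \<Rightarrow> real \<Rightarrow>
    (side \<Rightarrow> (real^'n) \<times> real \<times> (real^'d) \<Rightarrow> real^'n \<Rightarrow> real^'n) \<Rightarrow> bool" where
  "spectral_isos A dn Us pb \<delta> isom \<longleftrightarrow> (\<forall>\<sigma>.
     smooth_on (param_dom dn Us pb \<delta> \<sigma> \<times> E_base A dn pb \<sigma>) (\<lambda>(\<theta>, x). isom \<sigma> \<theta> x) \<and>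
     (\<forall>\<theta>\<in>param_dom dn Us pb \<delta> \<sigma>.
        (\<exists>f. linear f \<and> (\<forall>x\<in>E_base A dn pb \<sigma>. isom \<sigma> \<theta> x = f x)) \<and>
        bij_betw (isom \<sigma> \<theta>) (E_base A dn pb \<sigma>) (EE (- sg \<sigma>) (Gd A dn \<theta>))))"

definition half_profile :: "('d::finite \<Rightarrow> real^'n \<Rightarrow> real^'n^'n) \<Rightarrow> 'd \<Rightarrow> (real^'n) set \<Rightarrow>
    (side \<Rightarrow> (real^'n) \<times> real \<times> (real^'d) \<Rightarrow> real^'n \<Rightarrow> real^'n) \<Rightarrow> real \<Rightarrow>
    side \<Rightarrow> (real^'n) \<times> real \<times> (real^'d) \<Rightarrow> real^'n \<Rightarrow> (real \<Rightarrow> real^'n) \<Rightarrow> bool" where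
  "half_profile A dn Ustar isom R \<sigma> \<theta> a w \<longleftrightarrow>
     (let H = half_line \<sigma>; w1 = (\<lambda>z. vector_derivative w (at z within H)) in
       (case \<theta> of (p, s, h) \<Rightarrow>
          profile_solution A dn Ustar s h H w \<and> (w \<longlongrightarrow> p) (end_filter \<sigma>)) \<and>
       spectral_proj (- sg \<sigma>) (Gd A dn \<theta>) (w1 0) = isom \<sigma> \<theta> a \<and>
       (\<lambda>z. norm (w1 z)) integrable_on H \<and> integral H (\<lambda>z. norm (w1 z)) \<le> R \<and>
       (\<forall>z\<in>H. norm (w1 z) \<le> R))"

text \<open>\<open>\<Phi> \<sigma> z \<theta> a\<close> with \<open>\<theta> = (p\<^sub>\<sigma>, s, h)\<close> is $\Phi_\pm(z,p_\pm,s,h,a_\pm)$, extended in \<open>z\<close> to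
  the maximal interval of existence \<open>J \<sigma> \<theta> a\<close>. Off this interval its values are irrelevant.\<close>

definition half_profile_family :: "('d::finite \<Rightarrow> real^'n \<Rightarrow> real^'n^'n) \<Rightarrow> 'd \<Rightarrow> (real^'n) set \<Rightarrow>
    (side \<Rightarrow> (real^'n) set) \<Rightarrow> (side \<Rightarrow> real^'n) \<Rightarrow> real \<Rightarrow>
    (side \<Rightarrow> (real^'n) \<times> real \<times> (real^'d) \<Rightarrow> real^'n \<Rightarrow> real^'n) \<Rightarrow> real \<Rightarrow> real \<Rightarrow>
    (side \<Rightarrow> real \<Rightarrow> (real^'n) \<times> real \<times> (real^'d) \<Rightarrow> real^'n \<Rightarrow> real^'n) \<Rightarrow>
    (side \<Rightarrow> (real^'n) \<times> real \<times> (real^'d) \<Rightarrow> real^'n \<Rightarrow> real set) \<Rightarrow> bool" where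
  "half_profile_family A dn Ustar Us pb \<delta> isom R r \<Phi> J \<longleftrightarrow> 0 < \<delta> \<and> 0 < R \<and> 0 < r \<and> (\<forall>\<sigma>.
     (\<forall>\<theta>\<in>param_dom dn Us pb \<delta> \<sigma>. \<forall>a\<in>amp_dom A dn pb r \<sigma>.
        half_profile A dn Ustar isom R \<sigma> \<theta> a (\<lambda>z. \<Phi> \<sigma> z \<theta> a) \<and>
        (\<forall>w. half_profile A dn Ustar isom R \<sigma> \<theta> a w \<longrightarrow> (\<forall>z\<in>half_line \<sigma>. w z = \<Phi> \<sigma> z \<theta> a)) \<and>
        open (J \<sigma> \<theta> a) \<and> is_interval (J \<sigma> \<theta> a) \<and> half_line \<sigma> \<subseteq> J \<sigma> \<theta> a \<and>
        (case \<theta> of (p, s, h) \<Rightarrow>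
           profile_solution A dn Ustar s h (J \<sigma> \<theta> a) (\<lambda>z. \<Phi> \<sigma> z \<theta> a) \<and>
           (\<forall>J' w. open J' \<and> is_interval J' \<and> J \<sigma> \<theta> a \<subseteq> J' \<and> profile_solution A dn Ustar s h J' w \<and>
              (\<forall>z\<in>J \<sigma> \<theta> a. w z = \<Phi> \<sigma> z \<theta> a) \<longrightarrow> J' = J \<sigma> \<theta> a))) \<and>
     smooth_on {(z, \<theta>, a). \<theta> \<in> param_dom dn Us pb \<delta> \<sigma> \<and> a \<in> amp_dom A dn pb r \<sigma> \<and> z \<in> J \<sigma> \<theta> a}
       (\<lambda>(z, \<theta>, a). \<Phi> \<sigma> z \<theta> a))"

definition phi :: "(side \<Rightarrow> real \<Rightarrow> (real^'n) \<times> real \<times> (real^'d) \<Rightarrow> real^'n \<Rightarrow> real^'n) \<Rightarrow> real \<Rightarrow>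
    side \<Rightarrow> real \<Rightarrow> (real^'n) \<times> real \<times> (real^'d) \<Rightarrow> real^'n \<Rightarrow> real^'n" where
  "phi \<Phi> zb \<sigma> z \<theta> a = \<Phi> \<sigma> (z + sg \<sigma> * zb) \<theta> a"

text \<open>Points \<open>q = (p, s, h)\<close> with \<open>p = (p\<^sub>+, p\<^sub>-)\<close>, and amplitudes \<open>a = (a\<^sub>+, a\<^sub>-)\<close>.\<close>

definition params :: "side \<Rightarrow> ((real^'n) \<times> (real^'n)) \<times> real \<times> (real^'d) \<Rightarrow>
    (real^'n) \<times> real \<times> (real^'d)" where
  "params \<sigma> = (\<lambda>(p, s, h). (side_of \<sigma> p, s, h))"

definition base_match :: "('d::finite \<Rightarrow> real^'n \<Rightarrow> real^'n^'n) \<Rightarrow> 'd \<Rightarrow> (side \<Rightarrow> real^'n) \<Rightarrow>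
    (real \<Rightarrow> real^'n) \<Rightarrow> real \<Rightarrow>
    (side \<Rightarrow> real \<Rightarrow> (real^'n) \<times> real \<times> (real^'d) \<Rightarrow> real^'n \<Rightarrow> real^'n) \<Rightarrow>
    (side \<Rightarrow> (real^'n) \<times> real \<times> (real^'d) \<Rightarrow> real^'n \<Rightarrow> real set) \<Rightarrow>
    real \<Rightarrow> (real^'n) \<times> (real^'n) \<Rightarrow> bool" where
  "base_match A dn pb wb r \<Phi> J zb ab \<longleftrightarrow> zb \<le> 0 \<and> (\<forall>\<sigma>.
     side_of \<sigma> ab \<in> amp_dom A dn pb r \<sigma> \<and>
     (\<forall>z\<in>half_line \<sigma>. z + sg \<sigma> * zb \<in> J \<sigma> (pb \<sigma>, 0, 0) (side_of \<sigma> ab) \<and>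
        wb z = phi \<Phi> zb \<sigma> z (pb \<sigma>, 0, 0) (side_of \<sigma> ab)))"

definition Psi :: "(side \<Rightarrow> real \<Rightarrow> (real^'n) \<times> real \<times> (real^'d) \<Rightarrow> real^'n \<Rightarrow> real^'n) \<Rightarrow> real \<Rightarrow>
    (real \<Rightarrow> real^'n) \<Rightarrow> ((real^'n) \<times> (real^'n)) \<times> real \<times> (real^'d) \<Rightarrow> (real^'n) \<times> (real^'n) \<Rightarrow>
    (real^'n) \<times> (real^'n) \<times> real" where
  "Psi \<Phi> zb wb q a =
     (let f = (\<lambda>\<sigma> z. phi \<Phi> zb \<sigma> z (params \<sigma> q) (side_of \<sigma> a));
          wz = vector_derivative wb (at 0);
          s = fst (snd q) in
      (f Plus 0 - f Minus 0,
       vector_derivative (f Plus) (at 0) - vector_derivative (f Minus) (at 0),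
       s + f Plus 0 \<bullet> wz - wb 0 \<bullet> wz))"

definition profile_manifold :: "('d::finite \<Rightarrow> real^'n \<Rightarrow> real^'n^'n) \<Rightarrow> 'd \<Rightarrow>
    (side \<Rightarrow> (real^'n) set) \<Rightarrow> (side \<Rightarrow> real^'n) \<Rightarrow> (real \<Rightarrow> real^'n) \<Rightarrow> nat \<Rightarrow> real \<Rightarrow> real \<Rightarrow>
    (side \<Rightarrow> real \<Rightarrow> (real^'n) \<times> real \<times> (real^'d) \<Rightarrow> real^'n \<Rightarrow> real^'n) \<Rightarrow>
    (side \<Rightarrow> (real^'n) \<times> real \<times> (real^'d) \<Rightarrow> real^'n \<Rightarrow> real set) \<Rightarrow>
    real \<Rightarrow> (real^'n) \<times> (real^'n) \<Rightarrow>
    (((real^'n) \<times> (real^'n)) \<times> real \<times> (real^'d)) set \<Rightarrow>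
    (((real^'n) \<times> (real^'n)) \<times> real \<times> (real^'d) \<Rightarrow> (real^'n) \<times> (real^'n)) \<Rightarrow>
    (real \<Rightarrow> ((real^'n) \<times> (real^'n)) \<times> real \<times> (real^'d) \<Rightarrow> real^'n) \<Rightarrow> bool" where
  "profile_manifold A dn Us pb wb k \<delta> r \<Phi> J zb ab CB asol W \<longleftrightarrow>
     smooth_submanifold (CARD('n) + CARD('d) - k) CB \<and>
     smooth_on CB asol \<and>
     ((pb Plus, pb Minus), 0, 0) \<in> CB \<and> asol ((pb Plus, pb Minus), 0, 0) = ab \<and>
     (\<forall>q\<in>CB. Psi \<Phi> zb wb q (asol q) = 0 \<and>
       (\<forall>\<sigma>. params \<sigma> q \<in> param_dom dn Us pb \<delta> \<sigma> \<and> side_of \<sigma> (asol q) \<in> amp_dom A dn pb r \<sigma> \<and>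
         (\<forall>z\<in>half_line \<sigma>. z + sg \<sigma> * zb \<in> J \<sigma> (params \<sigma> q) (side_of \<sigma> (asol q)) \<and>
            W z q = phi \<Phi> zb \<sigma> z (params \<sigma> q) (side_of \<sigma> (asol q)))))"

text \<open>The amplitude \<open>a\<close> ranges over the linear space \<open>Ea\<close>, so $\nabla_a$ is the derivative within
  the amplitude domain \<open>Da\<close>; it is determined on \<open>Ea\<close>, and its rank is the dimension of the image
  of \<open>Ea\<close>.\<close>

definition strongly_transversal :: "('d::finite \<Rightarrow> real^'n \<Rightarrow> real^'n^'n) \<Rightarrow> 'd \<Rightarrow>
    (side \<Rightarrow> real^'n) \<Rightarrow> (real \<Rightarrow> real^'n) \<Rightarrow> nat \<Rightarrow> real \<Rightarrow>
    (side \<Rightarrow> real \<Rightarrow> (real^'n) \<times> real \<times> (real^'d) \<Rightarrow> real^'n \<Rightarrow> real^'n) \<Rightarrow> real \<Rightarrow>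
    (((real^'n) \<times> (real^'n)) \<times> real \<times> (real^'d) \<Rightarrow> (real^'n) \<times> (real^'n)) \<Rightarrow>
    ((real^'n) \<times> (real^'n)) \<times> real \<times> (real^'d) \<Rightarrow> bool" where
  "strongly_transversal A dn pb wb k r \<Phi> zb asol q \<longleftrightarrow>
     (let Ea = E_base A dn pb Plus \<times> E_base A dn pb Minus;
          Da = amp_dom A dn pb r Plus \<times> amp_dom A dn pb r Minus in
      (\<exists>D. ((\<lambda>a. Psi \<Phi> zb wb q a) has_derivative D) (at (asol q) within Da) \<and>
           dim (D ` Ea) = CARD('n) + 1 - k) \<and>
      (\<exists>D. ((\<lambda>(a, p). Psi \<Phi> zb wb (p, snd q) a) has_derivative D)
              (at (asol q, fst q) within (Da \<times> UNIV)) \<and>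
           dim (D ` (Ea \<times> UNIV)) = 2 * CARD('n) + 1))"


section \<open>The linearized operator\<close>

text \<open>Frequencies are \<open>\<zeta> = (\<tau>, \<gamma>, \<eta>)\<close>, with \<open>\<eta> $ dn = 0\<close>.\<close>

definition freq_sphere :: "'d \<Rightarrow> (real \<times> real \<times> (real^'d::finite)) set" where
  "freq_sphere dn = {(\<tau>, \<gamma>, \<eta>). norm (\<tau>, \<gamma>, \<eta>) = 1 \<and> 0 \<le> \<gamma> \<and> \<eta> $ dn = 0}"

definition freq_ball :: "'d \<Rightarrow> real \<Rightarrow> (real \<times> real \<times> (real^'d::finite)) set" where
  "freq_ball dn \<rho> = {(\<tau>, \<gamma>, \<eta>). norm (\<tau>, \<gamma>, \<eta>) \<le> \<rho> \<and> 0 \<le> \<gamma> \<and> \<eta> $ dn = 0}"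

text \<open>The matrix $\partial_w\mathcal A_d(w,s,h)u$, complex linear in \<open>u\<close>.\<close>

definition dcalA :: "('d::finite \<Rightarrow> real^'n \<Rightarrow> real^'n^'n) \<Rightarrow> 'd \<Rightarrow>
    real^'n \<Rightarrow> real \<Rightarrow> real^'d \<Rightarrow> complex^'n \<Rightarrow> complex^'n^'n" where
  "dcalA A dn w s h u = (\<chi> i j. \<Sum>k\<in>UNIV. u $ k * complex_of_real
     (frechet_derivative (\<lambda>v. calA A dn v s h) (at w) (axis k 1) $ i $ j))"

text \<open>\<open>linL \<dots> w \<zeta> u0 u1 u2 z\<close> is $(\mathcal Lu)(z)$ for the profile \<open>w = W(\<cdot>,q)\<close>, where
  \<open>u0, u1, u2\<close> are the values of $u, u', u''$ at \<open>z\<close>. Recall $A_0 = I$.\<close>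

definition linL :: "('d::finite \<Rightarrow> real^'n \<Rightarrow> real^'n^'n) \<Rightarrow> 'd \<Rightarrow> (real \<Rightarrow> real^'n) \<Rightarrow>
    real \<Rightarrow> real^'d \<Rightarrow> real \<times> real \<times> (real^'d) \<Rightarrow>
    complex^'n \<Rightarrow> complex^'n \<Rightarrow> complex^'n \<Rightarrow> real \<Rightarrow> complex^'n" where
  "linL A dn w s h = (\<lambda>(\<tau>, \<gamma>, \<eta>) u0 u1 u2 z.
     - (complex_of_real (1 + (norm h)\<^sup>2) *s u2)
     + cmat (calA A dn (w z) s h) *v u1
     + (2 * (\<Sum>j\<in>UNIV - {dn}. complex_of_real (h $ j) * \<i> * complex_of_real (\<eta> $ j))) *s u1
     + dcalA A dn (w z) s h u0 *v cvec (vector_derivative w (at z))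
     + (\<i> * complex_of_real \<tau> + complex_of_real \<gamma>) *s u0
     + (\<Sum>j\<in>UNIV - {dn}. (\<i> * complex_of_real (\<eta> $ j)) *s (cmat (A j (w z)) *v u0))
     + complex_of_real ((norm \<eta>)\<^sup>2) *s u0)"

definition linL1 :: "('d::finite \<Rightarrow> real^'n \<Rightarrow> real^'n^'n) \<Rightarrow> 'd \<Rightarrow> (real \<Rightarrow> real^'n) \<Rightarrow>
    real^'d \<Rightarrow> real \<times> real \<times> (real^'d) \<Rightarrow> real \<Rightarrow> complex^'n" where
  "linL1 A dn w h = (\<lambda>(\<tau>, \<gamma>, \<eta>) z.
     let w1 = (\<lambda>y. vector_derivative w (at y)); w2 = (\<lambda>y. vector_derivative w1 (at y)) in
       (\<i> * complex_of_real \<tau> + complex_of_real \<gamma>) *s cvec (w1 z)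
     + (\<Sum>j\<in>UNIV - {dn}. (\<i> * complex_of_real (\<eta> $ j)) *s (cmat (A j (w z)) *v cvec (w1 z)))
     + (2 * (\<Sum>j\<in>UNIV - {dn}. complex_of_real (h $ j) * \<i> * complex_of_real (\<eta> $ j))) *s cvec (w2 z)
     + complex_of_real ((norm \<eta>)\<^sup>2) *s cvec (w1 z))"

text \<open>\<open>u\<close> solves $\mathcal Lu = f$ on the half-line of side \<open>\<sigma>\<close>, with derivative \<open>u1\<close>.\<close>

definition linL_solution :: "('d::finite \<Rightarrow> real^'n \<Rightarrow> real^'n^'n) \<Rightarrow> 'd \<Rightarrow>
    (real \<Rightarrow> ((real^'n) \<times> (real^'n)) \<times> real \<times> (real^'d) \<Rightarrow> real^'n) \<Rightarrow>
    ((real^'n) \<times> (real^'n)) \<times> real \<times> (real^'d) \<Rightarrow> real \<times> real \<times> (real^'d) \<Rightarrow> side \<Rightarrow>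
    (real \<Rightarrow> complex^'n) \<Rightarrow> (real \<Rightarrow> complex^'n) \<Rightarrow> (real \<Rightarrow> complex^'n) \<Rightarrow> bool" where
  "linL_solution A dn W = (\<lambda>(p, s, h) \<zeta> \<sigma> f u u1. \<exists>u2. \<forall>z\<in>half_line \<sigma>.
     (u has_vector_derivative u1 z) (at z within half_line \<sigma>) \<and>
     (u1 has_vector_derivative u2 z) (at z within half_line \<sigma>) \<and>
     linL A dn (\<lambda>y. W y (p, s, h)) s h \<zeta> (u z) (u1 z) (u2 z) z = f z)"


section \<open>Evans functions\<close>

definition join :: "'a^'m \<Rightarrow> 'a^'k \<Rightarrow> 'a^('m + 'k)" where
  "join x y = (\<chi> i. case i of Inl a \<Rightarrow> x $ a | Inr b \<Rightarrow> y $ b)"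

definition E_side :: "('d::finite \<Rightarrow> real^'n \<Rightarrow> real^'n^'n) \<Rightarrow> 'd \<Rightarrow>
    (real \<Rightarrow> ((real^'n) \<times> (real^'n)) \<times> real \<times> (real^'d) \<Rightarrow> real^'n) \<Rightarrow> side \<Rightarrow>
    ((real^'n) \<times> (real^'n)) \<times> real \<times> (real^'d) \<Rightarrow> real \<times> real \<times> (real^'d) \<Rightarrow> real \<Rightarrow>
    (complex^('n + 'n)) set" where
  "E_side A dn W \<sigma> q \<zeta>h \<rho> = {join (u 0) (u1 0) | u u1.
     linL_solution A dn W q (\<rho> *\<^sub>R \<zeta>h) \<sigma> (\<lambda>_. 0) u u1 \<and> bounded (u ` half_line \<sigma>)}"

definition E_prod :: "('d::finite \<Rightarrow> real^'n \<Rightarrow> real^'n^'n) \<Rightarrow> 'd \<Rightarrow>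
    (real \<Rightarrow> ((real^'n) \<times> (real^'n)) \<times> real \<times> (real^'d) \<Rightarrow> real^'n) \<Rightarrow>
    ((real^'n) \<times> (real^'n)) \<times> real \<times> (real^'d) \<Rightarrow> real \<times> real \<times> (real^'d) \<Rightarrow> real \<Rightarrow>
    (complex^(('n + 'n) + ('n + 'n))) set" where
  "E_prod A dn W q \<zeta>h \<rho> =
     {join Vm Vp | Vm Vp. Vm \<in> E_side A dn W Minus q \<zeta>h \<rho> \<and> Vp \<in> E_side A dn W Plus q \<zeta>h \<rho>}"

definition diagonal :: "(complex^('m::finite + 'm)) set" where
  "diagonal = {join U U | U. True}"

definition hinner :: "complex^'m \<Rightarrow> complex^'m \<Rightarrow> complex" where
  "hinner x y = (\<Sum>i\<in>UNIV. x $ i * cnj (y $ i))"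

definition orthonormal_basis :: "('b \<Rightarrow> complex^'m) \<Rightarrow> (complex^'m) set \<Rightarrow> bool" where
  "orthonormal_basis b E \<longleftrightarrow>
     (\<forall>i j. hinner (b i) (b j) = (if i = j then 1 else 0)) \<and> vec.span (range b) = E"

text \<open>$\det(E,F)$ computed in the bases \<open>b\<close> of \<open>E\<close> and \<open>c\<close> of \<open>F\<close>. A change of orthonormal bases
  multiplies it by a number of modulus 1, so the bases are kept as arguments.\<close>

definition det_pair :: "('b \<Rightarrow> complex^('b::finite + 'c)) \<Rightarrow> ('c::finite \<Rightarrow> complex^('b + 'c)) \<Rightarrow> complex" where
  "det_pair b c = det (\<chi> i j. (case j of Inl k \<Rightarrow> b k $ i | Inr l \<Rightarrow> c l $ i))"

text \<open>The point $(V^-,V^+,\phi)$ of $\mathbb C^{2N}\times\mathbb C^{2N}\times\mathbb C$; the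
  coordinates are listed in the order $V^-,\phi,V^+$ so that \<open>det_pair\<close> applies. Reordering
  coordinates only affects the sign of the determinant.\<close>

definition triple :: "complex^'m::finite \<Rightarrow> complex^'m \<Rightarrow> complex \<Rightarrow> complex^(('m + unit) + 'm)" where
  "triple Vm Vp \<phi> = join (join Vm (\<chi> _. \<phi>)) Vp"

text \<open>The orthonormal basis of \<open>E \<times> \<complex>\<close> obtained from an orthonormal basis of
  \<open>E \<subseteq> \<complex>\<^sup>2\<^sup>N \<times> \<complex>\<^sup>2\<^sup>N\<close> by adding $(0,0,1)$.\<close>

definition add_scalar :: "('m::finite \<Rightarrow> complex^('m + 'm)) \<Rightarrow> ('m + unit) \<Rightarrow> complex^(('m + unit) + 'm)" where
  "add_scalar b j = (case j of
     Inl k \<Rightarrow> triple (\<chi> i. b k $ Inl i) (\<chi> i. b k $ Inr i) 0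
   | Inr _ \<Rightarrow> triple 0 0 1)"

text \<open>$\check{\mathbf R}_\pm$: the quotient $\mathbf R_\pm/\rho$, extended to $\rho = 0$ by its limit
  (recall $\mathbf R_\pm(z,q,0) = 0$).\<close>

definition Rcheck :: "(side \<Rightarrow> real \<Rightarrow> 'q \<Rightarrow> real \<times> real \<times> (real^'d::finite) \<Rightarrow> complex^'n) \<Rightarrow>
    side \<Rightarrow> real \<Rightarrow> 'q \<Rightarrow> real \<times> real \<times> (real^'d) \<Rightarrow> real \<Rightarrow> complex^'n" where
  "Rcheck Rf \<sigma> z q \<zeta>h \<rho> =
     (if \<rho> = 0 then vector_derivative (\<lambda>t. Rf \<sigma> z q (t *\<^sub>R \<zeta>h)) (at 0 within {0..})
      else (1 / \<rho>) *\<^sub>R Rf \<sigma> z q (\<rho> *\<^sub>R \<zeta>h))"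

definition Rvec :: "(side \<Rightarrow> real \<Rightarrow> 'q \<Rightarrow> real \<times> real \<times> (real^'d::finite) \<Rightarrow> complex^'n) \<Rightarrow>
    side \<Rightarrow> 'q \<Rightarrow> real \<times> real \<times> (real^'d) \<Rightarrow> real \<Rightarrow> complex^('n + 'n)" where
  "Rvec Rf \<sigma> q \<zeta>h \<rho> = join (Rcheck Rf \<sigma> 0 q \<zeta>h \<rho>)
     (vector_derivative (\<lambda>z. Rcheck Rf \<sigma> z q \<zeta>h \<rho>) (at 0 within half_line \<sigma>))"

definition corrector :: "('d::finite \<Rightarrow> real^'n \<Rightarrow> real^'n^'n) \<Rightarrow> 'd \<Rightarrow> (real \<Rightarrow> real^'n) \<Rightarrow>
    (((real^'n) \<times> (real^'n)) \<times> real \<times> (real^'d)) set \<Rightarrow>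
    (real \<Rightarrow> ((real^'n) \<times> (real^'n)) \<times> real \<times> (real^'d) \<Rightarrow> real^'n) \<Rightarrow> real \<Rightarrow>
    (side \<Rightarrow> real \<Rightarrow> ((real^'n) \<times> (real^'n)) \<times> real \<times> (real^'d) \<Rightarrow> real \<times> real \<times> (real^'d) \<Rightarrow>
       complex^'n) \<Rightarrow> bool" where
  "corrector A dn wb CB W \<rho>1 Rf \<longleftrightarrow> 0 < \<rho>1 \<and> (\<forall>\<sigma>.
     smooth_on (half_line \<sigma> \<times> CB \<times> freq_ball dn \<rho>1) (\<lambda>(z, q, \<zeta>). Rf \<sigma> z q \<zeta>) \<and>
     (\<forall>q\<in>CB. \<forall>\<zeta>\<in>freq_ball dn \<rho>1.
        (\<exists>C. \<exists>\<kappa>>0. \<forall>z\<in>half_line \<sigma>. norm (Rf \<sigma> z q \<zeta>) \<le> C * exp (- \<kappa> * \<bar>z\<bar>)) \<and>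
        (\<exists>u1. linL_solution A dn W q \<zeta> \<sigma> (linL1 A dn (\<lambda>y. W y q) (snd (snd q)) \<zeta>)
           (\<lambda>z. Rf \<sigma> z q \<zeta>) u1) \<and>
        (case \<zeta> of (\<tau>, \<gamma>, \<eta>) \<Rightarrow>
           (\<Sum>i\<in>UNIV. cvec (vector_derivative wb (at 0)) $ i * Rf \<sigma> 0 q \<zeta> $ i) =
           - (\<i> * complex_of_real \<tau> + complex_of_real \<gamma> + complex_of_real ((norm \<eta>)\<^sup>2)))) \<and>
     (\<forall>q\<in>CB. \<forall>z\<in>half_line \<sigma>. Rf \<sigma> z q 0 = 0 \<and>
        (\<exists>b0 b. \<forall>(\<tau>, \<gamma>, \<eta>)\<in>freq_sphere dn. Rcheck Rf \<sigma> z q (\<tau>, \<gamma>, \<eta>) 0 =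
           (\<i> * complex_of_real \<tau> + complex_of_real \<gamma>) *s b0 +
           (\<Sum>j\<in>UNIV - {dn}. (\<i> * complex_of_real (\<eta> $ j)) *s b j))))"

definition G_mod :: "(real \<Rightarrow> real^'n) \<Rightarrow>
    (side \<Rightarrow> real \<Rightarrow> 'q \<Rightarrow> real \<times> real \<times> (real^'d::finite) \<Rightarrow> complex^'n) \<Rightarrow>
    'q \<Rightarrow> real \<times> real \<times> (real^'d) \<Rightarrow> real \<Rightarrow> (complex^((('n + 'n) + unit) + ('n + 'n))) set" where
  "G_mod wb Rf q \<zeta>h \<rho> = {triple Vm Vp \<phi> | Vm Vp \<phi>.
     Vp - Vm = \<phi> *s (Rvec Rf Minus q \<zeta>h \<rho> - Rvec Rf Plus q \<zeta>h \<rho>) \<and>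
     (\<Sum>i\<in>UNIV. join (cvec (vector_derivative wb (at 0))) 0 $ i * Vp $ i) = 0}"

text \<open>$D_s$ and $D_m$, computed with an orthonormal basis \<open>BE q \<zeta>h \<rho>\<close> of \<open>E\<^sub>- \<times> E\<^sub>+\<close>,
  an orthonormal basis \<open>BD\<close> of the diagonal, and an orthonormal basis \<open>BG q \<zeta>h \<rho>\<close> of
  $\mathbb G'$. The same \<open>BE\<close> enters both functions.\<close>

definition D_std :: "('q \<Rightarrow> 'z \<Rightarrow> real \<Rightarrow> 'm::finite \<Rightarrow> complex^('m + 'm)) \<Rightarrow> ('m \<Rightarrow> complex^('m + 'm)) \<Rightarrow>
    'q \<Rightarrow> 'z \<Rightarrow> real \<Rightarrow> complex" where
  "D_std BE BD q \<zeta>h \<rho> = det_pair (BE q \<zeta>h \<rho>) BD"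

definition D_mod :: "('q \<Rightarrow> 'z \<Rightarrow> real \<Rightarrow> 'm::finite \<Rightarrow> complex^('m + 'm)) \<Rightarrow>
    ('q \<Rightarrow> 'z \<Rightarrow> real \<Rightarrow> 'm \<Rightarrow> complex^(('m + unit) + 'm)) \<Rightarrow> 'q \<Rightarrow> 'z \<Rightarrow> real \<Rightarrow> complex" where
  "D_mod BE BG q \<zeta>h \<rho> = det_pair (add_scalar (BE q \<zeta>h \<rho>)) (BG q \<zeta>h \<rho>)"

end

theory Submission
  imports Defs
begin

text \<open>The error term is in fact zero: the two Evans functions differ by an explicit smooth factor, and
  the reason is linear algebra on the space \<open>E = E\<^sub>- \<times> E\<^sub>+\<close>, which has as many dimensions as one
  copy of the phase space $\mathbb C^{2N}$.

  Both determinants pair a space with the kernel of a surjection. The diagonal is the kernel of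
  the jump \<open>(V\<^sup>-, V\<^sup>+) \<mapsto> V\<^sup>+ - V\<^sup>-\<close>, and $\mathbb G'$ is the kernel of
  \<open>(V\<^sup>-, V\<^sup>+, \<phi>) \<mapsto> (V\<^sup>+ - V\<^sup>- - \<phi> (R\<^sup>- - R\<^sup>+), l \<cdot> V\<^sup>+)\<close> with \<open>l = (w\<^sub>z(0), 0)\<close>, where \<open>w\<^sub>z\<close>
  belongs to the base profile. Such a determinant
  equals the determinant of the surjection restricted to the first space, times a factor that
  depends only on the basis of the kernel (\<open>det_pair_eq_det_image\<close>). Hence \<open>D\<^sub>s = c\<^sub>0 det Y\<close>
  with a constant \<open>c\<^sub>0 \<noteq> 0\<close>, where \<open>Y\<close> is the matrix of the jump on \<open>E\<close>, and \<open>D\<^sub>m = g det M\<close> with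
  \<open>g \<noteq> 0\<close>, where \<open>M\<close> is \<open>Y\<close> bordered by the column \<open>-(R\<^sup>- - R\<^sup>+)\<close> and the row of the
  products of \<open>l\<close> with the \<open>+\<close> parts of the basis of \<open>E\<close>. The factor \<open>g\<close> is
  as smooth as the chosen basis of $\mathbb G'$, and bounded because that basis is orthonormal.

  The two matrices are linked by one vector of \<open>E\<close>. Differentiating the profile equation gives
  $\mathcal L W' = \mathcal L_1$, so that \<open>W' - R\<^sub>\<plusminus>\<close> is a bounded solution of $\mathcal L u = 0$ on
  each half-line (\<open>profile_minus_corrector_in_E_side\<close>). The Cauchy data of \<open>W'\<close> are the same on
  both sides and cancel in the jump, so the pair of the Cauchy data of \<open>W' - R\<^sub>\<plusminus>\<close> has jump
  \<open>\<rho> (R\<^sup>- - R\<^sup>+)\<close>: up to sign, \<open>\<rho>\<close> times the extra column of \<open>M\<close>. Clearing this column leaves the entry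
  \<open>d / \<rho>\<close> in the corner, where \<open>d\<close> is the component of the \<open>+\<close> data along \<open>l\<close>, and
  \<open>\<rho> det M = d det Y\<close> (\<open>det_bordered\<close>). Together, \<open>D\<^sub>s = \<rho> c\<^sub>0 / (g d) D\<^sub>m\<close>.

  The normalization of the correctors evaluates
  \<open>d = w\<^sub>z(0) \<cdot> W\<^sub>z(0, q) + \<rho> (i \<tau> + \<gamma>) + \<rho>\<^sup>2 \<bar>\<eta>\<bar>\<^sup>2\<close>, with real part at least \<open>w\<^sub>z(0) \<cdot> W\<^sub>z(0, q)\<close>. At
  the base point this is \<open>\<bar>w\<^sub>z(0)\<bar>\<^sup>2\<close>; it is positive since a zero \<open>w\<^sub>z(0)\<close> would contradict the
  normalization itself. By continuity in \<open>q\<close> it stays positive near the base point, which gives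
  the neighbourhood \<open>Q\<close>, the smoothness of \<open>\<alpha> = c\<^sub>0 / (g d)\<close> and its lower bound.\<close>

section \<open>Calculus of smooth maps\<close>

lemma Ck_on_subset: "Ck_on k U f \<Longrightarrow> V \<subseteq> U \<Longrightarrow> Ck_on k V f"
  by (induction k arbitrary: f) (auto intro: continuous_on_subset)

lemma Ck_on_cong:
  assumes "open U" "\<And>x. x \<in> U \<Longrightarrow> f x = g x" "Ck_on k U f"
  shows "Ck_on k U g"
  using assms(2,3)
proof (induction k arbitrary: f g)
  case 0
  then show ?case using continuous_on_cong by fastforce
next
  case (Suc k)
  have *: "(g has_derivative frechet_derivative f (at x)) (at x)" if x: "x \<in> U" for x
  proof (rule has_derivative_transform_within_open[OF _ assms(1) x])
    show "(f has_derivative frechet_derivative f (at x)) (at x)"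
      using Suc.prems(2) x by (simp flip: frechet_derivative_works)
  qed (use Suc.prems in auto)
  have "Ck_on k U (\<lambda>x. frechet_derivative g (at x) v)" for v
    by (rule Suc.IH[of "\<lambda>x. frechet_derivative f (at x) v"])
      (use Suc.prems frechet_derivative_at[OF *] in auto)
  with * show ?case by (auto simp: differentiable_def)
qed

text \<open>An introduction rule that accepts any known derivative and so avoids the description of
  \<open>frechet_derivative\<close> by choice.\<close>

lemma Ck_on_SucI:
  assumes "open U" "\<And>x. x \<in> U \<Longrightarrow> (f has_derivative f' x) (at x)"
    and "\<And>v. Ck_on k U (\<lambda>x. f' x v)"
  shows "Ck_on (Suc k) U f"
proof -
  have "f differentiable (at x)" if "x \<in> U" for x
    using assms(2)[OF that] by (auto simp: differentiable_def)
  moreover have "Ck_on k U (\<lambda>x. frechet_derivative f (at x) v)" for v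
  proof (rule Ck_on_cong[OF assms(1) _ assms(3)])
    show "f' x v = frechet_derivative f (at x) v" if "x \<in> U" for x
      using frechet_derivative_at[OF assms(2)[OF that]] by simp
  qed
  ultimately show ?thesis by simp
qed

lemma Ck_on_SucD: "Ck_on (Suc k) U f \<Longrightarrow> Ck_on k U f"
proof (induction k arbitrary: f)
  case 0
  then show ?case
    by (simp add: continuous_at_imp_continuous_on differentiable_imp_continuous_within)
next
  case (Suc k)
  then show ?case by simp
qed

lemma Ck_on_const: "open U \<Longrightarrow> Ck_on k U (\<lambda>x. c)"
proof (induction k arbitrary: c)
  case (Suc k)
  show ?case by (rule Ck_on_SucI[where f' = "\<lambda>x v. 0"]) (use Suc in auto)
qed auto

lemma Ck_on_bounded_linear:
  assumes "bounded_linear L" "open U" "Ck_on k U f"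
  shows "Ck_on k U (\<lambda>x. L (f x))"
  using assms(3)
proof (induction k arbitrary: f)
  case 0
  then show ?case using assms(1) by (simp add: bounded_linear.continuous_on)
next
  case (Suc k)
  show ?case
  proof (rule Ck_on_SucI[where f' = "\<lambda>x v. L (frechet_derivative f (at x) v)"])
    fix x assume "x \<in> U"
    then have "(f has_derivative frechet_derivative f (at x)) (at x)"
      using Suc.prems by (simp add: frechet_derivative_works)
    then show "((\<lambda>x. L (f x)) has_derivative (\<lambda>v. L (frechet_derivative f (at x) v))) (at x)"
      by (rule bounded_linear.has_derivative[OF assms(1)])
  qed (use Suc assms in auto)
qed

lemma Ck_on_id:
  assumes "open U"
  shows "Ck_on k U (\<lambda>x. x)"
proof (cases k)
  case (Suc k)
  show ?thesis unfolding Suc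
    by (rule Ck_on_SucI[where f' = "\<lambda>x v. v"]) (use assms Ck_on_const in auto)
qed auto

lemma Ck_on_add:
  assumes "open U" "Ck_on k U f" "Ck_on k U g"
  shows "Ck_on k U (\<lambda>x. f x + g x)"
  using assms(2,3)
proof (induction k arbitrary: f g)
  case 0
  then show ?case by (simp add: continuous_on_add)
next
  case (Suc k)
  show ?case
    by (rule Ck_on_SucI[where f' = "\<lambda>x v. frechet_derivative f (at x) v + frechet_derivative g (at x) v"])
      (use Suc assms(1) in \<open>auto intro!: has_derivative_add simp flip: frechet_derivative_works\<close>)
qed

lemma Ck_on_sum:
  assumes "open U" "\<And>i. i \<in> I \<Longrightarrow> Ck_on k U (f i)"
  shows "Ck_on k U (\<lambda>x. \<Sum>i\<in>I. f i x)"
  using assms(2)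
  by (induction I rule: infinite_finite_induct) (auto intro: Ck_on_const Ck_on_add assms(1))

lemma Ck_on_bilinear:
  assumes "bounded_bilinear B" "open U" "Ck_on k U f" "Ck_on k U g"
  shows "Ck_on k U (\<lambda>x. B (f x) (g x))"
  using assms(3,4)
proof (induction k arbitrary: f g)
  case 0
  then show ?case using assms(1) by (simp add: bounded_bilinear.continuous_on)
next
  case (Suc k)
  have fg: "Ck_on k U f" "Ck_on k U g" using Suc.prems by (blast dest: Ck_on_SucD)+
  show ?case
    by (rule Ck_on_SucI[where f' = "\<lambda>x v. B (f x) (frechet_derivative g (at x) v) +
          B (frechet_derivative f (at x) v) (g x)"])
      (use Suc fg assms(1,2) in
        \<open>auto intro!: bounded_bilinear.FDERIV Ck_on_add simp flip: frechet_derivative_works\<close>)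
qed

text \<open>The chain rule differentiates \<open>g\<close> in the direction of a derivative of \<open>f\<close>, which moves with the
  point, while \<open>Ck_on\<close> speaks of constant directions only. Expanding the moving direction in a
  basis of the middle space reduces it to constant ones.\<close>

lemma Ck_on_compose:
  fixes f :: "'a::real_normed_vector \<Rightarrow> 'b::euclidean_space" and g :: "'b \<Rightarrow> 'c::real_normed_vector"
  assumes "open U" "open V" "f ` U \<subseteq> V" "Ck_on k U f" "Ck_on k V g"
  shows "Ck_on k U (\<lambda>x. g (f x))"
  using assms(4,5)
proof (induction k arbitrary: g)
  case 0
  then show ?case using assms(3) by (auto intro: continuous_on_compose2)
next
  case (Suc k)
  let ?f' = "\<lambda>x. frechet_derivative f (at x)" and ?g' = "\<lambda>y. frechet_derivative g (at y)"
  have f': "(f has_derivative ?f' x) (at x)" if "x \<in> U" for x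
    using Suc.prems that by (simp flip: frechet_derivative_works)
  have g': "(g has_derivative ?g' y) (at y)" if "y \<in> V" for y
    using Suc.prems that by (simp flip: frechet_derivative_works)
  have fk: "Ck_on k U f" using Suc.prems(1) by (rule Ck_on_SucD)
  show ?case
  proof (rule Ck_on_SucI[where f' = "\<lambda>x v. \<Sum>b\<in>Basis. (?f' x v \<bullet> b) *\<^sub>R ?g' (f x) b"])
    fix x assume x: "x \<in> U"
    then have fx: "f x \<in> V" using assms(3) by auto
    have lin: "linear (?g' (f x))" using g'[OF fx] by (rule has_derivative_linear)
    have "?g' (f x) (?f' x v) = (\<Sum>b\<in>Basis. (?f' x v \<bullet> b) *\<^sub>R ?g' (f x) b)" for v
      by (subst euclidean_representation[symmetric, of "?f' x v"])
        (simp add: linear_sum[OF lin] linear_scale[OF lin] del: euclidean_representation)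
    then show "((\<lambda>x. g (f x)) has_derivative (\<lambda>v. \<Sum>b\<in>Basis. (?f' x v \<bullet> b) *\<^sub>R ?g' (f x) b)) (at x)"
      using has_derivative_compose[OF f'[OF x] g'[OF fx]] by simp
  next
    fix v
    have "Ck_on k U (\<lambda>x. ?f' x v \<bullet> b)" for b
      using Suc.prems(1) assms(1) bounded_linear_inner_left by (auto intro: Ck_on_bounded_linear)
    moreover have "Ck_on k U (\<lambda>x. ?g' (f x) b)" for b
      using Suc.IH[OF fk, of "\<lambda>y. ?g' y b"] Suc.prems(2) by simp
    ultimately show "Ck_on k U (\<lambda>x. \<Sum>b\<in>Basis. (?f' x v \<bullet> b) *\<^sub>R ?g' (f x) b)"
      by (intro Ck_on_sum Ck_on_bilinear[OF bounded_bilinear_scaleR] assms(1)) auto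
  qed (use assms(1) in auto)
qed

lemma Ck_on_inverse: "Ck_on k (- {0}) (inverse :: 'a::real_normed_field \<Rightarrow> 'a)"
proof (induction k)
  case 0
  show ?case by (auto intro!: continuous_intros)
next
  case (Suc k)
  note m = Ck_on_bilinear[OF bounded_bilinear_mult, of "- {0}" k]
  show ?case
  proof (rule Ck_on_SucI[where f' = "\<lambda>x v. - (inverse x * v * inverse x)"])
    show "Ck_on k (- {0}) (\<lambda>x. - (inverse x * v * inverse x))" for v :: 'a
      by (intro Ck_on_bounded_linear[OF bounded_linear_minus[OF bounded_linear_ident]] m Suc Ck_on_const)
        (auto simp: open_delete)
  qed (auto intro!: has_derivative_inverse' simp: open_delete has_derivative_inverse)
qed

lemma Ck_on_sqrt: "Ck_on k {0<..} sqrt"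
proof (induction k)
  case 0
  show ?case by (auto intro!: continuous_intros)
next
  case (Suc k)
  note m = Ck_on_bilinear[OF bounded_bilinear_mult, of "{0<..}" k]
  show ?case
  proof (rule Ck_on_SucI[where f' = "\<lambda>x. (*) (inverse (sqrt x) / 2)"])
    show "(sqrt has_derivative (*) (inverse (sqrt x) / 2)) (at x)" if "x \<in> {0<..}" for x
      using DERIV_real_sqrt[of x] that by (simp add: has_field_derivative_def)
    show "Ck_on k {0<..} (\<lambda>x. inverse (sqrt x) / 2 * v)" for v
      unfolding divide_inverse
      by (intro m Ck_on_const Ck_on_compose[OF _ _ _ Suc Ck_on_inverse]) (auto simp: open_delete)
  qed auto
qed

lemma smooth_onE:
  assumes "smooth_on S f" "x \<in> S"
  obtains U g where "open U" "x \<in> U" "\<And>k. Ck_on k U g" "\<And>y. y \<in> U \<inter> S \<Longrightarrow> g y = f y"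
proof -
  obtain U g where *: "open U \<and> x \<in> U \<and> (\<forall>k. Ck_on k U g) \<and> (\<forall>y\<in>U \<inter> S. g y = f y)"
    using bspec[OF assms(1)[unfolded smooth_on_def] assms(2)] by (elim exE)
  show thesis by (rule that[of U g]) (use * in simp_all)
qed

lemma smooth_onI:
  assumes "\<And>x. x \<in> S \<Longrightarrow> \<exists>U g. open U \<and> x \<in> U \<and> (\<forall>k. Ck_on k U g) \<and> (\<forall>y\<in>U \<inter> S. g y = f y)"
  shows "smooth_on S f"
  unfolding smooth_on_def by (intro ballI assms)

lemma smooth_on_subset:
  assumes "smooth_on S f" "T \<subseteq> S"
  shows "smooth_on T f"
proof (rule smooth_onI)
  fix x assume "x \<in> T"
  then have "x \<in> S" using assms(2) by auto
  obtain U g where "open U" "x \<in> U" "\<And>k. Ck_on k U g" "\<And>y. y \<in> U \<inter> S \<Longrightarrow> g y = f y"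
    by (rule smooth_onE[OF assms(1) \<open>x \<in> S\<close>], rule that)
  then show "\<exists>U g. open U \<and> x \<in> U \<and> (\<forall>k. Ck_on k U g) \<and> (\<forall>y\<in>U \<inter> T. g y = f y)"
    using assms(2) by (intro exI[of _ U] exI[of _ g]) auto
qed

lemma smooth_on_cong:
  assumes "\<And>x. x \<in> S \<Longrightarrow> f x = g x" "smooth_on S f"
  shows "smooth_on S g"
proof (rule smooth_onI)
  fix x assume "x \<in> S"
  obtain U h where "open U" "x \<in> U" "\<And>k. Ck_on k U h" "\<And>y. y \<in> U \<inter> S \<Longrightarrow> h y = f y"
    by (rule smooth_onE[OF assms(2) \<open>x \<in> S\<close>], rule that)
  then show "\<exists>U h. open U \<and> x \<in> U \<and> (\<forall>k. Ck_on k U h) \<and> (\<forall>y\<in>U \<inter> S. h y = g y)"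
    using assms(1) by (intro exI[of _ U] exI[of _ h]) auto
qed

lemma smooth_on_open:
  assumes "open U" "\<And>k. Ck_on k U f"
  shows "smooth_on U f"
  by (rule smooth_onI) (use assms in \<open>auto intro!: exI[of _ U] exI[of _ f]\<close>)

lemma smooth_on_const: "smooth_on S (\<lambda>x. c)"
  by (rule smooth_on_subset[OF smooth_on_open[of UNIV]]) (auto intro: Ck_on_const)

lemma smooth_on_linear: "bounded_linear L \<Longrightarrow> smooth_on S L"
  by (rule smooth_on_subset[OF smooth_on_open[of UNIV]])
    (auto intro: Ck_on_bounded_linear[of L UNIV _ "\<lambda>x. x"] Ck_on_id)

lemma smooth_on_bilinear:
  assumes "bounded_bilinear B" "smooth_on S f" "smooth_on S g"
  shows "smooth_on S (\<lambda>x. B (f x) (g x))"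
proof (rule smooth_onI)
  fix x assume x: "x \<in> S"
  obtain U f1 where U: "open U" "x \<in> U" "\<And>k. Ck_on k U f1" "\<And>y. y \<in> U \<inter> S \<Longrightarrow> f1 y = f y"
    by (rule smooth_onE[OF assms(2) x], rule that)
  obtain V g1 where V: "open V" "x \<in> V" "\<And>k. Ck_on k V g1" "\<And>y. y \<in> V \<inter> S \<Longrightarrow> g1 y = g y"
    by (rule smooth_onE[OF assms(3) x], rule that)
  have "Ck_on k (U \<inter> V) (\<lambda>x. B (f1 x) (g1 x))" for k
    by (intro Ck_on_bilinear[OF assms(1)] Ck_on_subset[OF U(3)] Ck_on_subset[OF V(3)]) (use U V in auto)
  then show "\<exists>W h. open W \<and> x \<in> W \<and> (\<forall>k. Ck_on k W h) \<and> (\<forall>y\<in>W \<inter> S. h y = B (f y) (g y))"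
    using U V by (intro exI[of _ "U \<inter> V"] exI[of _ "\<lambda>x. B (f1 x) (g1 x)"]) auto
qed

lemma smooth_on_add:
  assumes "smooth_on S f" "smooth_on S g"
  shows "smooth_on S (\<lambda>x. f x + g x)"
proof (rule smooth_onI)
  fix x assume x: "x \<in> S"
  obtain U f1 where U: "open U" "x \<in> U" "\<And>k. Ck_on k U f1" "\<And>y. y \<in> U \<inter> S \<Longrightarrow> f1 y = f y"
    by (rule smooth_onE[OF assms(1) x], rule that)
  obtain V g1 where V: "open V" "x \<in> V" "\<And>k. Ck_on k V g1" "\<And>y. y \<in> V \<inter> S \<Longrightarrow> g1 y = g y"
    by (rule smooth_onE[OF assms(2) x], rule that)
  have "Ck_on k (U \<inter> V) (\<lambda>x. f1 x + g1 x)" for k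
    by (intro Ck_on_add Ck_on_subset[OF U(3)] Ck_on_subset[OF V(3)]) (use U V in auto)
  then show "\<exists>W h. open W \<and> x \<in> W \<and> (\<forall>k. Ck_on k W h) \<and> (\<forall>y\<in>W \<inter> S. h y = f y + g y)"
    using U V by (intro exI[of _ "U \<inter> V"] exI[of _ "\<lambda>x. f1 x + g1 x"]) auto
qed

lemma smooth_on_imp_continuous_on:
  assumes "smooth_on S f"
  shows "continuous_on S f"
  unfolding continuous_on_eq_continuous_within
proof
  fix x assume x: "x \<in> S"
  obtain U f1 where U: "open U" "x \<in> U" "\<And>k. Ck_on k U f1" "\<And>y. y \<in> U \<inter> S \<Longrightarrow> f1 y = f y"
    by (rule smooth_onE[OF assms x], rule that)
  have "isCont f1 x" using U(3)[of 0] U(1,2) continuous_on_eq_continuous_at by auto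
  then have "continuous (at x within S) f1" by (rule continuous_at_imp_continuous_at_within)
  then have "(f1 \<longlongrightarrow> f x) (at x within S)" using U(2,4) x by (simp add: continuous_within)
  then have "(f \<longlongrightarrow> f x) (at x within S)"
    by (rule Lim_transform_eventually)
      (use U(1,2,4) in \<open>auto simp: eventually_at_topological intro!: exI[of _ U]\<close>)
  then show "continuous (at x within S) f" by (simp add: continuous_within)
qed

lemma smooth_on_compose:
  fixes f :: "'a::real_normed_vector \<Rightarrow> 'b::euclidean_space" and g :: "'b \<Rightarrow> 'c::real_normed_vector"
  assumes g: "smooth_on T g" and f: "smooth_on S f" and ST: "\<And>x. x \<in> S \<Longrightarrow> f x \<in> T"
  shows "smooth_on S (\<lambda>x. g (f x))"
proof (rule smooth_onI)
  fix x assume x: "x \<in> S"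
  obtain U f1 where U: "open U" "x \<in> U" "\<And>k. Ck_on k U f1" "\<And>y. y \<in> U \<inter> S \<Longrightarrow> f1 y = f y"
    by (rule smooth_onE[OF f x], rule that)
  obtain V g1 where V: "open V" "f x \<in> V" "\<And>k. Ck_on k V g1" "\<And>y. y \<in> V \<inter> T \<Longrightarrow> g1 y = g y"
    by (rule smooth_onE[OF g ST[OF x]], rule that)
  define X where "X = U \<inter> f1 -` V"
  have X: "open X" unfolding X_def
    using U(1) U(3)[of 0] V(1) by (simp add: Int_commute continuous_on_open_vimage)
  have "Ck_on k X (\<lambda>x. g1 (f1 x))" for k
    by (rule Ck_on_compose[OF X V(1) _ Ck_on_subset[OF U(3)] V(3)]) (auto simp: X_def)
  moreover have "x \<in> X" using x U V by (auto simp: X_def)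
  moreover have "g1 (f1 y) = g (f y)" if "y \<in> X \<inter> S" for y
    using that U(4)[of y] V(4)[of "f y"] ST[of y] by (auto simp: X_def)
  ultimately show "\<exists>W h. open W \<and> x \<in> W \<and> (\<forall>k. Ck_on k W h) \<and> (\<forall>y\<in>W \<inter> S. h y = g (f y))"
    using X by blast
qed

lemma smooth_on_linear_compose:
  fixes f :: "'a::real_normed_vector \<Rightarrow> 'b::euclidean_space"
  shows "bounded_linear L \<Longrightarrow> smooth_on S f \<Longrightarrow> smooth_on S (\<lambda>x. L (f x))"
  by (rule smooth_on_compose[OF smooth_on_linear[of L UNIV]]) auto

lemma smooth_on_Pair:
  fixes f :: "'a::real_normed_vector \<Rightarrow> 'b::euclidean_space" and g :: "'a \<Rightarrow> 'c::euclidean_space"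
  assumes "smooth_on S f" "smooth_on S g"
  shows "smooth_on S (\<lambda>x. (f x, g x))"
proof -
  have "bounded_linear (\<lambda>u::'b. (u, 0::'c))" "bounded_linear (\<lambda>u::'c. (0::'b, u))"
    by (auto intro!: bounded_linear_Pair bounded_linear_ident bounded_linear_zero)
  from this[THEN smooth_on_linear_compose] assms
  have "smooth_on S (\<lambda>x. (f x, 0::'c))" "smooth_on S (\<lambda>x. (0::'b, g x))" by blast+
  from smooth_on_add[OF this] show ?thesis by simp
qed

lemmas smooth_on_mult = smooth_on_bilinear[OF bounded_bilinear_mult]

lemma smooth_on_sum:
  "(\<And>i. i \<in> I \<Longrightarrow> smooth_on S (f i)) \<Longrightarrow> smooth_on S (\<lambda>x. \<Sum>i\<in>I. f i x)"
  by (induction I rule: infinite_finite_induct) (auto intro: smooth_on_const smooth_on_add)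

lemma smooth_on_prod:
  fixes f :: "'i \<Rightarrow> 'a::real_normed_vector \<Rightarrow> 'b::real_normed_field"
  shows "(\<And>i. i \<in> I \<Longrightarrow> smooth_on S (f i)) \<Longrightarrow> smooth_on S (\<lambda>x. \<Prod>i\<in>I. f i x)"
  by (induction I rule: infinite_finite_induct) (auto intro: smooth_on_const smooth_on_mult)

lemma smooth_on_det:
  fixes M :: "'a::real_normed_vector \<Rightarrow> complex^'n^'n"
  assumes "\<And>i j. smooth_on S (\<lambda>x. M x $ i $ j)"
  shows "smooth_on S (\<lambda>x. det (M x))"
  unfolding det_def by (intro smooth_on_sum smooth_on_mult smooth_on_const smooth_on_prod assms)

lemma smooth_on_inverse:
  fixes f :: "'a::real_normed_vector \<Rightarrow> 'b::{real_normed_field,euclidean_space}"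
  assumes "smooth_on S f" "\<And>x. x \<in> S \<Longrightarrow> f x \<noteq> 0"
  shows "smooth_on S (\<lambda>x. inverse (f x))"
  by (rule smooth_on_compose[OF smooth_on_open[of "- {0}"] assms(1)])
    (use assms(2) in \<open>auto simp: Ck_on_inverse open_delete\<close>)

lemma smooth_on_norm: "smooth_on (- {0}) (norm :: 'a::euclidean_space \<Rightarrow> real)"
proof -
  have "smooth_on (- {0}) (\<lambda>x::'a. sqrt (x \<bullet> x))"
    by (rule smooth_on_compose[OF smooth_on_open[of "{0<..}"]
          smooth_on_bilinear[OF bounded_bilinear_inner]])
      (auto simp: Ck_on_sqrt intro: smooth_on_linear)
  then show ?thesis by (simp add: norm_eq_sqrt_inner[abs_def])
qed

text \<open>On \<open>S\<close> the partial derivative in \<open>z\<close> agrees with that of any local smooth extension, because the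
  sections of \<open>S\<close> in the \<open>z\<close> direction are open: nearby points of the section also see the
  extension.\<close>

lemma smooth_on_partial_derivative:
  fixes f :: "real \<Rightarrow> 'a::real_normed_vector \<Rightarrow> 'b::real_normed_vector"
  assumes f: "smooth_on S (\<lambda>(z, y). f z y)"
    and S: "\<And>y. open {z. (z, y) \<in> S}"
  shows "smooth_on S (\<lambda>(z, y). vector_derivative (\<lambda>z. f z y) (at z))"
proof (rule smooth_onI)
  fix x assume "x \<in> S"
  obtain U g where U: "open U" "x \<in> U" "\<And>k. Ck_on k U g" "\<And>y. y \<in> U \<inter> S \<Longrightarrow> g y = (\<lambda>(z, y). f z y) y"
    by (rule smooth_onE[OF f \<open>x \<in> S\<close>], rule that)
  let ?g' = "\<lambda>x. frechet_derivative g (at x) (1, 0)"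
  have "Ck_on k U ?g'" for k using U(3)[of "Suc k"] by simp
  moreover have "?g' (z, y) = vector_derivative (\<lambda>z. f z y) (at z)" if zy: "(z, y) \<in> U \<inter> S" for z y
  proof -
    have g: "(g has_derivative frechet_derivative g (at (z, y))) (at (z, y))"
      using U(3)[of 1] zy by (simp flip: frechet_derivative_works)
    have "((\<lambda>t. (t, y)) has_derivative (\<lambda>t. (t, 0))) (at z)"
      by (auto intro!: derivative_eq_intros)
    from has_derivative_compose[OF this g]
    have *: "((\<lambda>t. g (t, y)) has_derivative (\<lambda>t. frechet_derivative g (at (z, y)) (t, 0))) (at z)" .
    have D: "((\<lambda>t. g (t, y)) has_vector_derivative ?g' (z, y)) (at z)"
      unfolding has_vector_derivative_def
    proof (rule has_derivative_eq_rhs[OF *], rule ext)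
      show "frechet_derivative g (at (z, y)) (t, 0) = t *\<^sub>R ?g' (z, y)" for t
        using linear_scale[OF has_derivative_linear[OF g], of t "(1, 0)"] by simp
    qed
    have "open ((\<lambda>t. (t, y)) -` U)"
      by (rule open_vimage[OF U(1)]) (auto intro!: continuous_intros)
    then have op: "open ((\<lambda>t. (t, y)) -` U \<inter> {t. (t, y) \<in> S})" using S by (intro open_Int)
    have "((\<lambda>t. f t y) has_vector_derivative ?g' (z, y)) (at z)"
    proof (rule has_vector_derivative_transform_within_open[OF D op])
      show "g (t, y) = f t y" if "t \<in> (\<lambda>t. (t, y)) -` U \<inter> {t. (t, y) \<in> S}" for t
        using U(4)[of "(t, y)"] that by simp
    qed (use zy in simp)
    then show ?thesis by (simp only: vector_derivative_at)
  qed
  ultimately show "\<exists>U g. open U \<and> x \<in> U \<and> (\<forall>k. Ck_on k U g) \<and>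
      (\<forall>y\<in>U \<inter> S. g y = (\<lambda>(z, y). vector_derivative (\<lambda>z. f z y) (at z)) y)"
    using U(1,2) by (intro exI[of _ U] exI[of _ ?g'] conjI allI ballI) auto
qed

lemma smooth_on_imp_differentiable:
  assumes "smooth_on U f" "open U" "x \<in> U"
  shows "f differentiable (at x)"
proof -
  obtain V g where V: "open V" "x \<in> V" "\<And>k. Ck_on k V g" "\<And>y. y \<in> V \<inter> U \<Longrightarrow> g y = f y"
    by (rule smooth_onE[OF assms(1,3)], rule that)
  have "g differentiable (at x)" using V(3)[of 1] V(2) by simp
  then obtain g' where "(g has_derivative g') (at x)" by (auto simp: differentiable_def)
  then have "(f has_derivative g') (at x)"
    by (rule has_derivative_transform_within_open[of _ _ _ _ "V \<inter> U"]) (use V assms in auto)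
  then show ?thesis by (auto simp: differentiable_def)
qed

section \<open>Determinants of adjoined bases\<close>

lemma UNIV_sum_split: "(\<Sum>x\<in>(UNIV::('a::finite + 'b::finite) set). f x) =
    (\<Sum>a\<in>UNIV. f (Inl a)) + (\<Sum>b\<in>UNIV. f (Inr b))"
  using sum.Plus[of UNIV UNIV f] by simp

lemma UNIV_prod_split: "(\<Prod>x\<in>(UNIV::('a::finite + 'b::finite) set). f x) =
    (\<Prod>a\<in>UNIV. f (Inl a)) * (\<Prod>b\<in>UNIV. f (Inr b))"
  using prod.Plus[of UNIV UNIV f] by simp

lemma permutes_UNIV_iff: "p permutes UNIV \<longleftrightarrow> bij p"
  by (simp add: permutes_def bij_iff)

lemma bij_map_sum:
  fixes p :: "'a \<Rightarrow> 'c" and q :: "'b \<Rightarrow> 'd"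
  assumes "bij p" "bij q"
  shows "bij (map_sum p q)"
proof (rule o_bij[of "map_sum (inv p) (inv q)"])
  show "map_sum (inv p) (inv q) \<circ> map_sum p q = id"
    unfolding map_sum.comp inv_o_cancel[OF bij_is_inj[OF assms(1)]] inv_o_cancel[OF bij_is_inj[OF assms(2)]]
    by (rule map_sum.id)
  have "p \<circ> inv p = id" "q \<circ> inv q = id"
    using assms by (simp_all only: bij_is_surj flip: surj_iff)
  then show "map_sum p q \<circ> map_sum (inv p) (inv q) = id"
    unfolding map_sum.comp by (simp only: map_sum.id)
qed

lemma swapidseq_map_sum:
  fixes p :: "'a \<Rightarrow> 'a" and q :: "'b \<Rightarrow> 'b"
  shows "swapidseq n p \<Longrightarrow> swapidseq n (map_sum p (id :: 'b \<Rightarrow> 'b))"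
  "swapidseq m q \<Longrightarrow> swapidseq m (map_sum (id :: 'a \<Rightarrow> 'a) q)"
proof -
  show "swapidseq n p \<Longrightarrow> swapidseq n (map_sum p (id :: 'b \<Rightarrow> 'b))"
  proof (induction rule: swapidseq.induct)
    case (comp_Suc n p a b)
    have "map_sum (Transposition.transpose a b \<circ> p) (id :: 'b \<Rightarrow> 'b) = Transposition.transpose (Inl a) (Inl b) \<circ> map_sum (p) (id :: 'b \<Rightarrow> 'b)"
      (is "?l = ?r")
    proof
      show "?l i = ?r i" for i
        by (cases i) (simp_all add: Transposition.transpose_def)
    qed
    then show ?case
      using swapidseq.comp_Suc[OF comp_Suc.IH, of "Inl a" "Inl b"] comp_Suc.hyps
      by (simp only: sum.inject not_False_eq_True)
  qed (simp only: map_sum.id swapidseq.id)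
  show "swapidseq m q \<Longrightarrow> swapidseq m (map_sum (id :: 'a \<Rightarrow> 'a) q)"
  proof (induction rule: swapidseq.induct)
    case (comp_Suc n p a b)
    have "map_sum (id :: 'a \<Rightarrow> 'a) (Transposition.transpose a b \<circ> p) = Transposition.transpose (Inr a) (Inr b) \<circ> map_sum (id :: 'a \<Rightarrow> 'a) (p)"
      (is "?l = ?r")
    proof
      show "?l i = ?r i" for i
        by (cases i) (simp_all add: Transposition.transpose_def)
    qed
    then show ?case
      using swapidseq.comp_Suc[OF comp_Suc.IH, of "Inr a" "Inr b"] comp_Suc.hyps
      by (simp only: sum.inject not_False_eq_True)
  qed (simp only: map_sum.id swapidseq.id)
qed

lemma sign_map_sum:
  assumes "permutation p" "permutation q"
  shows "sign (map_sum p q) = sign p * sign q"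
proof -
  obtain n m where n: "swapidseq n p" and m: "swapidseq m q"
    using assms by (auto simp: permutation_def)
  have "swapidseq (n + m) (map_sum p id \<circ> map_sum id q)"
    by (rule swapidseq_comp_add[OF swapidseq_map_sum(1)[OF n] swapidseq_map_sum(2)[OF m]])
  then have "swapidseq (n + m) (map_sum p q)" by (simp add: map_sum.comp)
  then have "evenperm (map_sum p q) \<longleftrightarrow> even (n + m)"
    by (rule evenperm_unique) simp
  moreover have "evenperm p \<longleftrightarrow> even n" "evenperm q \<longleftrightarrow> even m"
    using evenperm_unique[OF n refl] evenperm_unique[OF m refl] by simp_all
  ultimately show ?thesis by (auto simp: sign_def)
qed

text \<open>In the Leibniz sum only those permutations survive that map the upper index block to itself,
  hence also the lower one; they are pairs of permutations of the two blocks.\<close>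

lemma det_block_lower_triangular:
  fixes M :: "'a::comm_ring_1^('m::finite + 'n::finite)^('m + 'n)"
  assumes z: "\<And>i j. M $ Inl i $ Inr j = 0"
  shows "det M = det (\<chi> i j. M $ Inl i $ Inl j) * det (\<chi> i j. M $ Inr i $ Inr j)"
proof -
  let ?P = "{p. p permutes (UNIV :: ('m + 'n) set)}"
  let ?A = "{p. p permutes (UNIV :: 'm set)}" and ?B = "{p. p permutes (UNIV :: 'n set)}"
  let ?t = "\<lambda>p. of_int (sign p) * (\<Prod>i\<in>UNIV. M $ i $ p i)"
  let ?f = "\<lambda>(p :: 'm \<Rightarrow> 'm, q :: 'n \<Rightarrow> 'n). map_sum p q"
  have inj: "inj_on ?f (?A \<times> ?B)"
  proof (rule inj_onI, clarify)
    fix p p' :: "'m \<Rightarrow> 'm" and q q' :: "'n \<Rightarrow> 'n"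
    assume eq: "map_sum p q = map_sum p' q'"
    have "p i = p' i" for i using fun_cong[OF eq, of "Inl i"] by simp
    moreover have "q i = q' i" for i using fun_cong[OF eq, of "Inr i"] by simp
    ultimately show "p = p' \<and> q = q'" by blast
  qed
  have sub: "?f ` (?A \<times> ?B) \<subseteq> ?P"
    by (auto simp: permutes_UNIV_iff bij_map_sum)
  have zero: "?t p = 0" if p: "p \<in> ?P - ?f ` (?A \<times> ?B)" for p
  proof (rule ccontr)
    assume "?t p \<noteq> 0"
    have nz: "M $ i $ p i \<noteq> 0" for i
    proof
      assume "M $ i $ p i = 0"
      then have "(\<Prod>i\<in>UNIV. M $ i $ p i) = 0" by (intro prod_zero) auto
      with \<open>?t p \<noteq> 0\<close> show False by simp
    qed
    have bij: "bij p" using p by (auto simp: permutes_bij)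
    have "\<exists>b. p (Inl a) = Inl b" for a
      using nz[of "Inl a"] z[of a] by (cases "p (Inl a)") auto
    then obtain f where f: "\<And>a. p (Inl a) = Inl (f a)" by metis
    have "inj f" 
    proof (rule injI)
      fix a b assume "f a = f b"
      then have "p (Inl a) = p (Inl b)" by (simp add: f)
      then show "a = b" using bij by (simp add: bij_def inj_eq)
    qed
    then have sf: "bij f" by (simp add: bij_def finite_UNIV_inj_surj)
    have "\<exists>b. p (Inr a) = Inr b" for a
    proof (cases "p (Inr a)")
      case (Inl c)
      obtain d where "f d = c" using sf by (metis bij_pointE)
      then have "p (Inl d) = p (Inr a)" using f Inl by simp
      then show ?thesis using bij by (simp add: bij_def inj_eq)
    qed auto
    then obtain g where g: "\<And>a. p (Inr a) = Inr (g a)" by metis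
    have "inj g" 
    proof (rule injI)
      fix a b assume "g a = g b"
      then have "p (Inr a) = p (Inr b)" by (simp add: g)
      then show "a = b" using bij by (simp add: bij_def inj_eq)
    qed
    then have sg: "bij g" by (simp add: bij_def finite_UNIV_inj_surj)
    have "p = map_sum f g" by (rule ext, rename_tac a, case_tac a) (simp_all add: f g)
    then show False using p sf sg by (auto simp: permutes_UNIV_iff)
  qed
  have "det M = (\<Sum>p\<in>?f ` (?A \<times> ?B). ?t p)"
    unfolding det_def
  proof (rule sum.mono_neutral_right[OF _ sub])
    show "finite ?P" by (rule finite_permutations) simp
    show "\<forall>p\<in>?P - ?f ` (?A \<times> ?B). ?t p = 0" by (intro ballI zero)
  qed
  also have "\<dots> = (\<Sum>x\<in>?A \<times> ?B. ?t (?f x))"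
    using inj by (simp add: sum.reindex)
  also have "\<dots> = (\<Sum>(p, q)\<in>?A \<times> ?B. (of_int (sign p) * (\<Prod>i\<in>UNIV. M $ Inl i $ Inl (p i))) *
      (of_int (sign q) * (\<Prod>i\<in>UNIV. M $ Inr i $ Inr (q i))))"
  proof (intro sum.cong refl, clarify)
    fix p :: "'m \<Rightarrow> 'm" and q :: "'n \<Rightarrow> 'n"
    assume "p permutes UNIV" "q permutes UNIV"
    then have "sign (map_sum p q) = sign p * sign q"
      by (intro sign_map_sum) (auto simp: permutation_permutes)
    then show "?t (map_sum p q) = (of_int (sign p) * (\<Prod>i\<in>UNIV. M $ Inl i $ Inl (p i))) *
        (of_int (sign q) * (\<Prod>i\<in>UNIV. M $ Inr i $ Inr (q i)))"
      by (simp add: UNIV_prod_split mult_ac)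
  qed
  also have "\<dots> = det (\<chi> i j. M $ Inl i $ Inl j) * det (\<chi> i j. M $ Inr i $ Inr j)"
    unfolding det_def by (simp add: sum_product sum.cartesian_product)
  finally show ?thesis .
qed

lemma vec_span_range:
  fixes c :: "'b::finite \<Rightarrow> 'a::field^'n"
  assumes "v \<in> vec.span (range c)"
  shows "\<exists>y. v = (\<Sum>l\<in>UNIV. y l *s c l)"
  using assms
proof (induction rule: vec.span_induct_alt)
  case base
  show ?case by (rule exI[of _ "\<lambda>_. 0"]) simp
next
  case (step a x w)
  then obtain l y where "x = c l" "w = (\<Sum>l\<in>UNIV. y l *s c l)" by auto
  then have "a *s x + w = (\<Sum>k\<in>UNIV. (y k + (if k = l then a else 0)) *s c k)"
    by (simp add: vec.scale_left_distrib sum.distrib if_distrib[of "\<lambda>a. a *s _"] sum.delta cong: if_cong)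
  then show ?case by (rule exI[of _ "\<lambda>k. y k + (if k = l then a else 0)"])
qed

text \<open>Modulo the kernel of \<open>\<Lambda>\<close>, which the columns \<open>c\<close> span, each \<open>b k\<close> is the combination of the
  columns of the right inverse \<open>S\<close> with the same image under \<open>\<Lambda>\<close>. So the matrix \<open>(b | c)\<close> is
  \<open>(S | c)\<close> times a block triangular matrix whose diagonal blocks are the matrix of \<open>\<Lambda>\<close> on \<open>b\<close> and
  the identity.\<close>

lemma det_pair_eq_det_image:
  fixes b S :: "'b::finite \<Rightarrow> complex^('b + 'c::finite)" and c :: "'c \<Rightarrow> complex^('b + 'c)"
  assumes lin: "Vector_Spaces.linear (*s) (*s) \<Lambda>"
    and S: "\<And>i. \<Lambda> (S i) = axis i 1"
    and ker: "{v. \<Lambda> v = 0} \<subseteq> vec.span (range c)"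
  shows "det_pair b c = det_pair S c * det (\<chi> i k. \<Lambda> (b k) $ i)"
proof -
  interpret Vector_Spaces.linear "(*s)" "(*s)" \<Lambda> by (fact lin)
  have "\<exists>y. b k - (\<Sum>i\<in>UNIV. \<Lambda> (b k) $ i *s S i) = (\<Sum>l\<in>UNIV. y l *s c l)" for k
  proof (rule vec_span_range, rule subsetD[OF ker], simp)
    show "\<Lambda> (b k - (\<Sum>i\<in>UNIV. \<Lambda> (b k) $ i *s S i)) = 0"
      by (simp add: diff sum scale S basis_expansion)
  qed
  then obtain Y where Y: "\<And>k. b k - (\<Sum>i\<in>UNIV. \<Lambda> (b k) $ i *s S i) = (\<Sum>l\<in>UNIV. Y k l *s c l)"
    by metis
  define T :: "complex^('b + 'c)^('b + 'c)" where
    "T = (\<chi> i j. case j of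
        Inl k \<Rightarrow> (case i of Inl i \<Rightarrow> \<Lambda> (b k) $ i | Inr l \<Rightarrow> Y k l)
      | Inr l \<Rightarrow> (if i = Inr l then 1 else 0))"
  have "(\<chi> i j. case j of Inl k \<Rightarrow> b k $ i | Inr l \<Rightarrow> c l $ i) =
      (\<chi> i j. case j of Inl k \<Rightarrow> S k $ i | Inr l \<Rightarrow> c l $ i) ** T"
  proof -
    have "b k $ i = (\<Sum>j\<in>UNIV. \<Lambda> (b k) $ j * S j $ i) + (\<Sum>l\<in>UNIV. Y k l * c l $ i)" for k i
      using arg_cong[OF Y[of k], of "\<lambda>v. v $ i"] by (simp add: algebra_simps)
    then show ?thesis
      by (auto simp: vec_eq_iff matrix_matrix_mult_def T_def UNIV_sum_split mult.commute
          if_distrib[of "\<lambda>x. _ * x"] cong: if_cong split: sum.split)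
  qed
  moreover have "det T = det (\<chi> i k. \<Lambda> (b k) $ i)"
  proof -
    have "(\<chi> i j. T $ Inr i $ Inr j) = (mat 1 :: complex^'c^'c)"
      by (auto simp: T_def mat_def vec_eq_iff)
    moreover have "(\<chi> i j. T $ Inl i $ Inl j) = (\<chi> i k. \<Lambda> (b k) $ i)"
      by (simp add: T_def)
    ultimately show ?thesis
      using det_block_lower_triangular[of T] by (simp add: T_def)
  qed
  ultimately show ?thesis by (simp add: det_pair_def det_mul)
qed

lemma orthonormal_independent:
  fixes c :: "'c::finite \<Rightarrow> complex^'m"
  assumes "orthonormal_basis c E" "(\<Sum>l\<in>UNIV. y l *s c l) = 0"
  shows "y l = 0"
proof -
  have "0 = hinner (\<Sum>k\<in>UNIV. y k *s c k) (c l)" by (simp add: assms(2) hinner_def)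
  also have "\<dots> = (\<Sum>k\<in>UNIV. y k * hinner (c k) (c l))"
  proof -
    have "hinner (\<Sum>k\<in>UNIV. y k *s c k) (c l) =
        (\<Sum>i\<in>UNIV. \<Sum>k\<in>UNIV. y k * (c k $ i * cnj (c l $ i)))"
      by (simp add: hinner_def sum_distrib_right mult.assoc)
    also have "\<dots> = (\<Sum>k\<in>UNIV. y k * hinner (c k) (c l))"
      by (subst sum.swap) (simp add: hinner_def sum_distrib_left)
    finally show ?thesis .
  qed
  also have "\<dots> = y l"
    using assms(1) by (simp add: orthonormal_basis_def if_distrib[of "\<lambda>x. _ * x"] cong: if_cong)
  finally show ?thesis by simp
qed

text \<open>Applying \<open>\<Lambda>\<close> to a linear relation between the columns of \<open>S\<close> and \<open>c\<close> kills the part in \<open>c\<close>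
  and reads off the coefficients of \<open>S\<close>; the rest is the independence of \<open>c\<close>.\<close>

lemma det_pair_complement_nonzero:
  fixes S :: "'b::finite \<Rightarrow> complex^('b + 'c::finite)" and c :: "'c \<Rightarrow> complex^('b + 'c)"
  assumes lin: "Vector_Spaces.linear (*s) (*s) \<Lambda>"
    and S: "\<And>i. \<Lambda> (S i) = axis i 1"
    and on: "orthonormal_basis c {v. \<Lambda> v = 0}"
  shows "det_pair S c \<noteq> 0"
proof -
  interpret Vector_Spaces.linear "(*s)" "(*s)" \<Lambda> by (fact lin)
  let ?M = "(\<chi> i j. case j of Inl k \<Rightarrow> S k $ i | Inr l \<Rightarrow> c l $ i) :: complex^('b + 'c)^('b + 'c)"
  have "x = 0" if "?M *v x = 0" for x
  proof -
    have eq: "(\<Sum>k\<in>UNIV. x $ Inl k *s S k) + (\<Sum>l\<in>UNIV. x $ Inr l *s c l) = 0"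
      using that by (simp add: vec_eq_iff matrix_vector_mult_def UNIV_sum_split mult.commute)
    have c0: "\<Lambda> (c l) = 0" for l
      using on vec.span_base[of "c l" "range c"] by (auto simp: orthonormal_basis_def)
    have "0 = \<Lambda> ((\<Sum>k\<in>UNIV. x $ Inl k *s S k) + (\<Sum>l\<in>UNIV. x $ Inr l *s c l))" by (simp add: eq)
    also have "\<dots> = (\<Sum>k\<in>UNIV. x $ Inl k *s axis k 1)"
      by (simp add: add sum scale S c0)
    also have "\<dots> = (\<chi> k. x $ Inl k)"
      using basis_expansion[of "\<chi> k. x $ Inl k"] by simp
    finally have l: "x $ Inl k = 0" for k by (metis vec_lambda_beta zero_index)
    then have "x $ Inr k = 0" for k using eq orthonormal_independent[OF on] by simp
    with l show "x = 0" by (metis sumE vec_eq_iff zero_index)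
  qed
  then have "invertible ?M" by (simp add: invertible_left_inverse matrix_left_invertible_ker)
  then show ?thesis by (simp add: det_pair_def invertible_det_nz)
qed

lemma orthonormal_entry_le_1:
  assumes "orthonormal_basis (b :: 'c \<Rightarrow> complex^'m) E"
  shows "cmod (b l $ i) \<le> 1"
proof -
  have "complex_of_real (\<Sum>i\<in>UNIV. (cmod (b l $ i))\<^sup>2) = 1"
    using assms by (auto simp: orthonormal_basis_def hinner_def complex_norm_square simp del: of_real_power)
  then have "(\<Sum>i\<in>UNIV. (cmod (b l $ i))\<^sup>2) = 1" by (simp only: of_real_eq_1_iff)
  moreover have "(cmod (b l $ i))\<^sup>2 \<le> (\<Sum>i\<in>UNIV. (cmod (b l $ i))\<^sup>2)"
    by (rule member_le_sum) auto
  ultimately show ?thesis using power2_le_imp_le[of "cmod (b l $ i)" 1] by simp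
qed

text \<open>Each term of the Leibniz sum is bounded separately; a bound that depends on the size only is enough.\<close>

lemma cmod_det_le:
  fixes M :: "complex^'n^'n"
  assumes "\<And>i j. cmod (M $ i $ j) \<le> B"
  shows "cmod (det M) \<le> fact CARD('n) * B ^ CARD('n)"
proof -
  have "cmod (det M) \<le> (\<Sum>p\<in>{p. p permutes (UNIV::'n set)}. B ^ CARD('n))"
    unfolding det_def
  proof (rule sum_norm_le)
    fix p :: "'n \<Rightarrow> 'n"
    have "cmod (\<Prod>i\<in>UNIV. M $ i $ p i) \<le> B ^ CARD('n)"
      using prod_mono[of UNIV "\<lambda>i. cmod (M $ i $ p i)" "\<lambda>_. B"] assms by (simp add: prod_norm)
    then show "cmod (of_int (sign p) * (\<Prod>i\<in>UNIV. M $ i $ p i)) \<le> B ^ CARD('n)"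
      by (simp add: norm_mult sign_def)
  qed
  then show ?thesis by (simp add: card_permutations)
qed

text \<open>Multiply the last column of the bordered matrix by \<open>\<rho>\<close> and add the combination \<open>x\<close> of the others:
  since \<open>Y x = \<rho> r\<close>, this leaves only \<open>l \<cdot> x\<close> in the corner. The column operations are the matrix
  \<open>T\<close> below, of determinant \<open>\<rho>\<close>.\<close>

lemma det_bordered:
  fixes Y :: "complex^'m^'m::finite" and l x r :: "complex^'m"
  assumes Yx: "Y *v x = \<rho> *s r"
  shows "\<rho> * det (\<chi> i j. case j of
        Inl k \<Rightarrow> (case i of Inl i \<Rightarrow> Y $ i $ k | Inr (_::unit) \<Rightarrow> l $ k)
      | Inr (_::unit) \<Rightarrow> (case i of Inl i \<Rightarrow> - r $ i | Inr _ \<Rightarrow> 0)) =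
    det Y * (\<Sum>k\<in>UNIV. l $ k * x $ k)" (is "\<rho> * det ?M = _")
proof -
  define T :: "complex^('m + unit)^('m + unit)" where
    "T = (\<chi> i j. case i of
        Inl i \<Rightarrow> (case j of Inl j \<Rightarrow> (if i = j then 1 else 0) | Inr _ \<Rightarrow> x $ i)
      | Inr _ \<Rightarrow> (case j of Inl j \<Rightarrow> 0 | Inr _ \<Rightarrow> \<rho>))"
  have one: "det ((\<chi> i j. c) :: complex^unit^unit) = c" for c
    by (subst det_diagonal) auto
  have "det (Finite_Cartesian_Product.transpose T) = det (mat 1 :: complex^'m^'m) * det ((\<chi> i j. \<rho>) :: complex^unit^unit)"
    by (subst det_block_lower_triangular)
      (auto simp: T_def Finite_Cartesian_Product.transpose_def mat_def eq_commute)
  then have T: "det T = \<rho>" by (simp add: one)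
  have Yx': "(\<Sum>k\<in>UNIV. Y $ i $ k * x $ k) = \<rho> * r $ i" for i
    using arg_cong[OF Yx, of "\<lambda>v. v $ i"] by (simp add: matrix_vector_mult_def)
  have "\<rho> * det ?M = det (?M ** T)" by (simp add: det_mul T)
  also have "\<dots> = det Y * det ((\<chi> i j. (\<Sum>k\<in>UNIV. l $ k * x $ k)) :: complex^unit^unit)"
    by (subst det_block_lower_triangular)
      (auto simp: matrix_matrix_mult_def T_def UNIV_sum_split UNIV_unit Yx' if_distrib[of "\<lambda>x. _ * x"] cong: if_cong)
  finally show ?thesis by (simp add: one)
qed

section \<open>Gluing the half-line profiles\<close>

lemma half_line_0 [simp]: "0 \<in> half_line \<sigma>"
  by (simp add: half_line_def)

lemma at_within_half_line_nontrivial: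
  assumes "z \<in> half_line \<sigma>"
  shows "at z within half_line \<sigma> \<noteq> bot"
proof (cases \<sigma>)
  case Plus
  have "at_right z \<le> at z within half_line \<sigma>"
    by (rule at_le) (use assms Plus in \<open>auto simp: half_line_def\<close>)
  then show ?thesis using trivial_limit_at_right_real[of z] by (auto simp: bot_unique)
next
  case Minus
  have "at_left z \<le> at z within half_line \<sigma>"
    by (rule at_le) (use assms Minus in \<open>auto simp: half_line_def\<close>)
  then show ?thesis using trivial_limit_at_left_real[of z] by (auto simp: bot_unique)
qed

lemma has_vector_derivative_from_half_lines:
  assumes "\<And>\<sigma>. z \<in> half_line \<sigma> \<Longrightarrow> (f has_vector_derivative f') (at z within half_line \<sigma>)"
  shows "(f has_vector_derivative f') (at z)"
proof -
  have U: "half_line Plus \<union> half_line Minus = UNIV" by (auto simp: half_line_def)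
  consider "z > 0" | "z < 0" | "z = 0" by linarith
  then show ?thesis
  proof cases
    case 1
    then have "at z within half_line Plus = at z"
      by (intro at_within_nhd[of z "{0<..}"]) (auto simp: half_line_def)
    then show ?thesis using assms[of Plus] 1 by (simp add: half_line_def)
  next
    case 2
    then have "at z within half_line Minus = at z"
      by (intro at_within_nhd[of z "{..<0}"]) (auto simp: half_line_def)
    then show ?thesis using assms[of Minus] 2 by (simp add: half_line_def)
  next
    case 3
    then show ?thesis
      using assms[of Plus] assms[of Minus]
      unfolding has_vector_derivative_def has_derivative_within U[symmetric] Lim_within_Un by simp
  qed
qed

text \<open>The definition of a half-line profile bounds the derivative on the half-line, but matched
  profiles are shifted by \<open>c\<close>, possibly out of it. The compact segment that the shift adds lies
  in the interval of existence.\<close>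

lemma bounded_half_profile_derivative:
  assumes hp: "half_profile A dn Ustar isom R \<sigma> \<theta> a w"
    and I: "open I" "is_interval I" "half_line \<sigma> \<subseteq> I" "c \<in> I"
    and w1: "\<And>z. z \<in> I \<Longrightarrow> (w has_vector_derivative w1 z) (at z)"
      "\<And>z. z \<in> I \<Longrightarrow> (w1 has_vector_derivative w2 z) (at z)"
  shows "bounded (w1 ` ((\<lambda>z. z + c) ` half_line \<sigma>))"
proof -
  have "norm (w1 z) \<le> R" if "z \<in> half_line \<sigma>" for z
  proof -
    have "vector_derivative w (at z within half_line \<sigma>) = w1 z"
      using that I(3) by (intro vector_derivative_within at_within_half_line_nontrivial
          has_vector_derivative_at_within[OF w1(1)]) auto
    then show ?thesis using hp that by (auto simp: half_profile_def Let_def)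
  qed
  then have "bounded (w1 ` half_line \<sigma>)" by (auto simp: bounded_iff)
  moreover have "bounded (w1 ` closed_segment 0 c)"
  proof (rule compact_imp_bounded, rule compact_continuous_image)
    have "0 \<in> I" using I(3) by auto
    then have "closed_segment 0 c \<subseteq> I"
      using I(2,4) by (intro closed_segment_subset) (auto simp: is_interval_convex)
    then show "continuous_on (closed_segment 0 c) w1"
      using w1(2) by (auto intro!: continuous_at_imp_continuous_on has_vector_derivative_continuous)
  qed simp
  ultimately have "bounded (w1 ` (half_line \<sigma> \<union> closed_segment 0 c))"
    by (simp add: image_Un)
  moreover have "(\<lambda>z. z + c) ` half_line \<sigma> \<subseteq> half_line \<sigma> \<union> closed_segment 0 c"
    by (cases \<sigma>) (auto simp: half_line_def closed_segment_eq_real_ivl)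
  ultimately show ?thesis by (meson bounded_subset image_mono)
qed

text \<open>The two halves of a profile are glued at \<open>0\<close>. The matching map makes values and first derivatives
  agree there, and then the profile equation makes the second derivatives agree, so that the glued
  profile is twice differentiable on the whole line.\<close>

lemma profile_derivatives:
  fixes A :: "'d::finite \<Rightarrow> real^'n::finite \<Rightarrow> real^'n^'n"
  assumes family: "half_profile_family A dn Ustar Us pb \<delta> isom R r \<Phi> J"
    and manifold: "profile_manifold A dn Us pb wb k \<delta> r \<Phi> J zb ab CB asol W"
    and q: "q \<in> CB" "q = (p, s, h)"
  obtains w1 w2 where
    "\<And>z. W z q \<in> Ustar"
    "\<And>z. ((\<lambda>z. W z q) has_vector_derivative w1 z) (at z)"
    "\<And>z. (w1 has_vector_derivative w2 z) (at z)"
    "\<And>z. (1 + (norm h)\<^sup>2) *\<^sub>R w2 z = calA A dn (W z q) s h *v w1 z"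
    "\<And>\<sigma>. bounded (w1 ` half_line \<sigma>)"
    "w1 0 = vector_derivative (\<lambda>z. \<Phi> Plus z (params Plus q) (fst (asol q))) (at zb)"
proof -
  define a where "a \<sigma> = side_of \<sigma> (asol q)" for \<sigma>
  define f where "f \<sigma> z = phi \<Phi> zb \<sigma> z (params \<sigma> q) (a \<sigma>)" for \<sigma> z
  define I where "I \<sigma> = J \<sigma> (params \<sigma> q) (a \<sigma>)" for \<sigma>
  have dom: "params \<sigma> q \<in> param_dom dn Us pb \<delta> \<sigma>" "a \<sigma> \<in> amp_dom A dn pb r \<sigma>" for \<sigma>
    using manifold q(1) by (auto simp: profile_manifold_def a_def)
  have W: "z + sg \<sigma> * zb \<in> I \<sigma>" "W z q = f \<sigma> z" if "z \<in> half_line \<sigma>" for \<sigma> z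
    using manifold q(1) that by (auto simp: profile_manifold_def f_def a_def I_def)
  have Psi: "Psi \<Phi> zb wb q (asol q) = 0"
    using manifold q(1) by (auto simp: profile_manifold_def)
  have fam: "half_profile A dn Ustar isom R \<sigma> (params \<sigma> q) (a \<sigma>) (\<lambda>z. \<Phi> \<sigma> z (params \<sigma> q) (a \<sigma>))"
    and I: "open (I \<sigma>)" "is_interval (I \<sigma>)" "half_line \<sigma> \<subseteq> I \<sigma>"
    and sol: "profile_solution A dn Ustar s h (I \<sigma>) (\<lambda>z. \<Phi> \<sigma> z (params \<sigma> q) (a \<sigma>))" for \<sigma>
    using family[unfolded half_profile_family_def, THEN conjunct2, THEN conjunct2, THEN conjunct2,
        THEN spec, THEN conjunct1, THEN bspec, OF dom(1), THEN bspec, OF dom(2), of \<sigma>] q(2)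
    by (simp_all add: params_def I_def)
  have "\<exists>v1 v2. \<forall>z\<in>I \<sigma>. \<Phi> \<sigma> z (params \<sigma> q) (a \<sigma>) \<in> Ustar \<and>
      ((\<lambda>z. \<Phi> \<sigma> z (params \<sigma> q) (a \<sigma>)) has_vector_derivative v1 z) (at z) \<and>
      (v1 has_vector_derivative v2 z) (at z) \<and>
      (1 + (norm h)\<^sup>2) *\<^sub>R v2 z = calA A dn (\<Phi> \<sigma> z (params \<sigma> q) (a \<sigma>)) s h *v v1 z" for \<sigma>
    using sol[of \<sigma>] unfolding profile_solution_def by (simp only: at_within_open[OF _ I(1)] cong: ball_cong)
  then have "\<exists>v1 v2. \<forall>\<sigma>. \<forall>z\<in>I \<sigma>. \<Phi> \<sigma> z (params \<sigma> q) (a \<sigma>) \<in> Ustar \<and>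
      ((\<lambda>z. \<Phi> \<sigma> z (params \<sigma> q) (a \<sigma>)) has_vector_derivative v1 \<sigma> z) (at z) \<and>
      (v1 \<sigma> has_vector_derivative v2 \<sigma> z) (at z) \<and>
      (1 + (norm h)\<^sup>2) *\<^sub>R v2 \<sigma> z = calA A dn (\<Phi> \<sigma> z (params \<sigma> q) (a \<sigma>)) s h *v v1 \<sigma> z"
    by (subst choice_iff[symmetric] | rule allI | blast)+
  then obtain v1 v2 where v: "\<And>\<sigma> z. z \<in> I \<sigma> \<Longrightarrow> \<Phi> \<sigma> z (params \<sigma> q) (a \<sigma>) \<in> Ustar"
      "\<And>\<sigma> z. z \<in> I \<sigma> \<Longrightarrow> ((\<lambda>z. \<Phi> \<sigma> z (params \<sigma> q) (a \<sigma>)) has_vector_derivative v1 \<sigma> z) (at z)"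
      "\<And>\<sigma> z. z \<in> I \<sigma> \<Longrightarrow> (v1 \<sigma> has_vector_derivative v2 \<sigma> z) (at z)"
      "\<And>\<sigma> z. z \<in> I \<sigma> \<Longrightarrow> (1 + (norm h)\<^sup>2) *\<^sub>R v2 \<sigma> z = calA A dn (\<Phi> \<sigma> z (params \<sigma> q) (a \<sigma>)) s h *v v1 \<sigma> z"
    by blast
  define f1 where "f1 \<sigma> z = v1 \<sigma> (z + sg \<sigma> * zb)" for \<sigma> z
  define f2 where "f2 \<sigma> z = v2 \<sigma> (z + sg \<sigma> * zb)" for \<sigma> z
  have shift: "((\<lambda>z. g (z + c)) has_vector_derivative g') (at z)"
    if "(g has_vector_derivative g') (at (z + c))" for g :: "real \<Rightarrow> real^'n" and g' z c
  proof -
    have "((\<lambda>z. z + c) has_vector_derivative 1) (at z)"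
      by (auto intro!: derivative_eq_intros)
    from vector_diff_chain_at[OF this that] show ?thesis by (simp add: o_def)
  qed
  have f1: "(f \<sigma> has_vector_derivative f1 \<sigma> z) (at z)" if "z \<in> half_line \<sigma>" for \<sigma> z
    unfolding f_def[abs_def] phi_def f1_def by (rule shift[OF v(2)[OF W(1)[OF that]]])
  have f2: "(f1 \<sigma> has_vector_derivative f2 \<sigma> z) (at z)" if "z \<in> half_line \<sigma>" for \<sigma> z
    unfolding f1_def[abs_def] f2_def by (rule shift[OF v(3)[OF W(1)[OF that]]])
  have ode: "(1 + (norm h)\<^sup>2) *\<^sub>R f2 \<sigma> z = calA A dn (f \<sigma> z) s h *v f1 \<sigma> z" if "z \<in> half_line \<sigma>" for \<sigma> z
    using v(4)[OF W(1)[OF that]] by (simp add: f_def f1_def f2_def phi_def)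
  have f0: "f Plus 0 = f Minus 0" and
    "vector_derivative (f Plus) (at 0) = vector_derivative (f Minus) (at 0)"
    using Psi unfolding Psi_def Let_def f_def[abs_def] a_def[abs_def] by (simp_all add: zero_prod_def)
  then have f10: "f1 Plus 0 = f1 Minus 0"
    using f1[of 0 Plus] f1[of 0 Minus] by (simp add: vector_derivative_at)
  have pos: "1 + (norm h)\<^sup>2 \<noteq> 0" by (smt (verit) zero_le_power2)
  have f20: "f2 Plus 0 = f2 Minus 0"
    using ode[of 0 Plus] ode[of 0 Minus] f0 f10 pos by (metis half_line_0 real_vector.scale_left_imp_eq)
  define w1 where "w1 z = (if z \<ge> 0 then f1 Plus z else f1 Minus z)" for z
  define w2 where "w2 z = (if z \<ge> 0 then f2 Plus z else f2 Minus z)" for z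
  have w1: "w1 z = f1 \<sigma> z" and w2: "w2 z = f2 \<sigma> z" if "z \<in> half_line \<sigma>" for \<sigma> z
    using that f10 f20 by (cases \<sigma>; cases "z = 0"; auto simp: w1_def w2_def half_line_def)+
  have line: "\<exists>\<sigma>. z \<in> half_line \<sigma>" for z
    by (cases "z \<ge> 0") (auto simp: half_line_def intro: exI[of _ Plus] exI[of _ Minus])
  show thesis
  proof (rule that[of w1 w2])
    fix z
    obtain \<sigma> where z: "z \<in> half_line \<sigma>" using line by blast
    show "W z q \<in> Ustar" using v(1)[OF W(1)[OF z]] W(2)[OF z] by (simp add: f_def phi_def)
    show "(1 + (norm h)\<^sup>2) *\<^sub>R w2 z = calA A dn (W z q) s h *v w1 z"
      using ode[OF z] W(2)[OF z] w1[OF z] w2[OF z] by simp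
  next
    fix z
    show "((\<lambda>z. W z q) has_vector_derivative w1 z) (at z)"
    proof (rule has_vector_derivative_from_half_lines)
      fix \<sigma> assume z: "z \<in> half_line \<sigma>"
      show "((\<lambda>z. W z q) has_vector_derivative w1 z) (at z within half_line \<sigma>)"
        by (rule has_vector_derivative_transform[OF z W(2)])
          (use z w1 has_vector_derivative_at_within[OF f1[OF z]] in auto)
    qed
    show "(w1 has_vector_derivative w2 z) (at z)"
    proof (rule has_vector_derivative_from_half_lines)
      fix \<sigma> assume z: "z \<in> half_line \<sigma>"
      show "(w1 has_vector_derivative w2 z) (at z within half_line \<sigma>)"
        by (rule has_vector_derivative_transform[OF z w1])
          (use z w2 has_vector_derivative_at_within[OF f2[OF z]] in auto)
    qed
  next
    fix \<sigma>
    have "bounded (v1 \<sigma> ` (\<lambda>z. z + sg \<sigma> * zb) ` half_line \<sigma>)"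
      using W(1)[of 0 \<sigma>] by (intro bounded_half_profile_derivative[OF fam I _ v(2,3)]) auto
    moreover have "w1 ` half_line \<sigma> = v1 \<sigma> ` (\<lambda>z. z + sg \<sigma> * zb) ` half_line \<sigma>"
      by (auto simp: image_image w1 f1_def)
    ultimately show "bounded (w1 ` half_line \<sigma>)" by simp
  next
    have "w1 0 = v1 Plus zb" by (simp add: w1_def f1_def)
    then show "w1 0 = vector_derivative (\<lambda>z. \<Phi> Plus z (params Plus q) (fst (asol q))) (at zb)"
      using v(2)[of zb Plus] W(1)[of 0 Plus] by (simp add: a_def vector_derivative_at)
  qed
qed

section \<open>The derivative of the profile and the linearized operator\<close>

lemma cvec_nth [simp]: "cvec x $ i = complex_of_real (x $ i)"
  by (simp add: cvec_def)

lemma bounded_linear_cvec: "bounded_linear cvec"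
  unfolding linear_conv_bounded_linear[symmetric]
  by (rule linearI) (auto simp: vec_eq_iff scaleR_conv_of_real[where 'a = complex])

lemma cvec_add: "cvec (x + y) = cvec x + cvec y"
  by (simp add: vec_eq_iff)

lemma cvec_scaleR: "cvec (c *\<^sub>R x) = complex_of_real c *s cvec x"
  by (simp add: vec_eq_iff)

lemma cmat_mult_cvec: "cmat M *v cvec x = cvec (M *v x)"
  by (simp add: vec_eq_iff matrix_vector_mult_def cmat_def)

lemma calA_differentiable:
  fixes A :: "'d::finite \<Rightarrow> real^'n::finite \<Rightarrow> real^'n^'n"
  assumes "hyperbolic_system A Ustar Us" "u \<in> Ustar"
  shows "(\<lambda>v. calA A dn v s h) differentiable (at u)"
proof -
  have A: "A j differentiable (at u)" for j
    using assms smooth_on_imp_differentiable unfolding hyperbolic_system_def by blast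
  have "(\<lambda>v. \<Sum>j\<in>UNIV - {dn}. (h $ j) *\<^sub>R A j v) differentiable (at u)"
    by (intro differentiable_sum ballI differentiable_scaleR differentiable_const A) simp
  then show ?thesis
    unfolding calA_def by (intro differentiable_diff differentiable_const A)
qed

lemma dcalA_cvec:
  assumes "(\<lambda>v. calA A dn v s h) differentiable (at w)"
  shows "dcalA A dn w s h (cvec x) = cmat (frechet_derivative (\<lambda>v. calA A dn v s h) (at w) x)"
proof -
  let ?D = "frechet_derivative (\<lambda>v. calA A dn v s h) (at w)"
  have lin: "linear ?D" using assms by (rule linear_frechet_derivative)
  have "?D x = ?D (\<Sum>k\<in>UNIV. (x $ k) *\<^sub>R axis k 1)"
    using basis_expansion[of x] by (simp add: scalar_mult_eq_scaleR)
  also have "\<dots> = (\<Sum>k\<in>UNIV. (x $ k) *\<^sub>R ?D (axis k 1))"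
    by (simp add: linear_sum[OF lin] linear_scale[OF lin])
  finally have "?D x $ i $ j = (\<Sum>k\<in>UNIV. x $ k * ?D (axis k 1) $ i $ j)" for i j by simp
  then show ?thesis by (simp add: dcalA_def cmat_def vec_eq_iff)
qed

lemma bounded_bilinear_matrix_vector_mult:
  "bounded_bilinear (\<lambda>(M :: real^'n^'m) (x :: real^'n). M *v x)"
  unfolding bilinear_conv_bounded_bilinear[symmetric] bilinear_def
  by (auto intro!: linearI simp: algebra_simps matrix_vector_mult_def vec_eq_iff sum.distrib sum_distrib_left)

text \<open>This is the derivative of the profile equation: all terms of $\mathcal L W'$ without a frequency
  cancel, and those that remain make up $\mathcal L_1$. The equation itself provides the third
  derivative of the profile.\<close>

lemma profile_derivative_solves:
  fixes A :: "'d::finite \<Rightarrow> real^'n::finite \<Rightarrow> real^'n^'n"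
  assumes sys: "hyperbolic_system A Ustar Us"
    and W: "\<And>z. W z (p, s, h) \<in> Ustar"
    and w1: "\<And>z. ((\<lambda>z. W z (p, s, h)) has_vector_derivative w1 z) (at z)"
    and w2: "\<And>z. (w1 has_vector_derivative w2 z) (at z)"
    and ode: "\<And>z. (1 + (norm h)\<^sup>2) *\<^sub>R w2 z = calA A dn (W z (p, s, h)) s h *v w1 z"
  shows "linL_solution A dn W (p, s, h) \<zeta> \<sigma> (linL1 A dn (\<lambda>y. W y (p, s, h)) h \<zeta>)
    (\<lambda>z. cvec (w1 z)) (\<lambda>z. cvec (w2 z))"
proof -
  let ?W = "\<lambda>z. W z (p, s, h)" and ?H = "1 + (norm h)\<^sup>2"
  let ?K = "\<lambda>v. calA A dn v s h"
  let ?D = "\<lambda>z. frechet_derivative ?K (at (?W z))"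
  have pos: "?H \<noteq> 0" by (smt (verit) zero_le_power2)
  define w3 where "w3 z = (1 / ?H) *\<^sub>R (?K (?W z) *v w2 z + ?D z (w1 z) *v w1 z)" for z
  have dK: "?K differentiable (at (?W z))" for z by (rule calA_differentiable[OF sys W])
  have K: "((\<lambda>z. ?K (?W z)) has_vector_derivative ?D z (w1 z)) (at z)" for z
    using vector_derivative_diff_chain_within[OF w1[of z], of ?K "?D z"] dK[of z]
    by (simp add: o_def frechet_derivative_works has_derivative_at_withinI)
  have "w2 = (\<lambda>z. (1 / ?H) *\<^sub>R (?K (?W z) *v w1 z))"
  proof
    fix z show "w2 z = (1 / ?H) *\<^sub>R (?K (?W z) *v w1 z)"
      using pos by (simp flip: ode)
  qed
  moreover have "((\<lambda>z. (1 / ?H) *\<^sub>R (?K (?W z) *v w1 z)) has_vector_derivative w3 z) (at z)" for z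
    unfolding w3_def
    by (rule bounded_linear.has_vector_derivative[OF bounded_linear_scaleR_right
          bounded_bilinear.has_vector_derivative[OF bounded_bilinear_matrix_vector_mult K w2]])
  ultimately have w3: "(w2 has_vector_derivative w3 z) (at z)" for z by simp
  have Hw3: "?H *\<^sub>R w3 z = ?K (?W z) *v w2 z + ?D z (w1 z) *v w1 z" for z
    using pos by (simp add: w3_def)
  have d1: "vector_derivative ?W (at z) = w1 z" for z using w1 by (rule vector_derivative_at)
  have d2: "vector_derivative w1 (at z) = w2 z" for z using w2 by (rule vector_derivative_at)
  note cv = bounded_linear.has_vector_derivative[OF bounded_linear_cvec]
  show ?thesis
    unfolding linL_solution_def split
  proof (intro exI[of _ "\<lambda>z. cvec (w3 z)"] ballI conjI)
    fix z
    show "((\<lambda>z. cvec (w1 z)) has_vector_derivative cvec (w2 z)) (at z within half_line \<sigma>)"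
      "((\<lambda>z. cvec (w2 z)) has_vector_derivative cvec (w3 z)) (at z within half_line \<sigma>)"
      by (intro cv has_vector_derivative_at_within[OF w2] has_vector_derivative_at_within[OF w3])+
    obtain \<tau> \<gamma> \<eta> where \<zeta>: "\<zeta> = (\<tau>, \<gamma>, \<eta>)" by (metis prod.collapse)
    have "complex_of_real ?H *s cvec (w3 z) =
        cmat (?K (?W z)) *v cvec (w2 z) + dcalA A dn (?W z) s h (cvec (w1 z)) *v cvec (w1 z)"
      unfolding cvec_scaleR[symmetric] Hw3 dcalA_cvec[OF dK] cmat_mult_cvec cvec_add ..
    then show "linL A dn ?W s h \<zeta> (cvec (w1 z)) (cvec (w2 z)) (cvec (w3 z)) z = linL1 A dn ?W h \<zeta> z"
      unfolding \<zeta> linL_def linL1_def Let_def split d1 d2 by simp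
  qed
qed

lemma linL_diff:
  "linL A dn w s h \<zeta> (u0 - v0) (u1 - v1) (u2 - v2) z =
    linL A dn w s h \<zeta> u0 u1 u2 z - linL A dn w s h \<zeta> v0 v1 v2 z"
proof -
  obtain \<tau> \<gamma> \<eta> where \<zeta>: "\<zeta> = (\<tau>, \<gamma>, \<eta>)" by (metis prod.collapse)
  have d: "dcalA A dn (w z) s h (u0 - v0) = dcalA A dn (w z) s h u0 - dcalA A dn (w z) s h v0"
    by (simp add: dcalA_def vec_eq_iff left_diff_distrib sum_subtractf)
  show ?thesis
    unfolding \<zeta> linL_def split d
    by (simp add: matrix_vector_mult_diff_distrib matrix_vector_mult_diff_rdistrib
        vec.scale_right_diff_distrib sum_subtractf)
qed

lemma linL_solution_diff:
  assumes "linL_solution A dn W q \<zeta> \<sigma> f u u1" "linL_solution A dn W q \<zeta> \<sigma> f v v1"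
  shows "linL_solution A dn W q \<zeta> \<sigma> (\<lambda>_. 0) (\<lambda>z. u z - v z) (\<lambda>z. u1 z - v1 z)"
proof -
  obtain p s h where q: "q = (p, s, h)" by (metis prod.collapse)
  obtain u2 where u: "\<forall>z\<in>half_line \<sigma>. (u has_vector_derivative u1 z) (at z within half_line \<sigma>) \<and>
     (u1 has_vector_derivative u2 z) (at z within half_line \<sigma>) \<and>
     linL A dn (\<lambda>y. W y (p, s, h)) s h \<zeta> (u z) (u1 z) (u2 z) z = f z"
    using assms(1) unfolding linL_solution_def q by auto
  obtain v2 where v: "\<forall>z\<in>half_line \<sigma>. (v has_vector_derivative v1 z) (at z within half_line \<sigma>) \<and>
     (v1 has_vector_derivative v2 z) (at z within half_line \<sigma>) \<and>
     linL A dn (\<lambda>y. W y (p, s, h)) s h \<zeta> (v z) (v1 z) (v2 z) z = f z"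
    using assms(2) unfolding linL_solution_def q by auto
  show ?thesis
    unfolding linL_solution_def q split
    by (intro exI[of _ "\<lambda>z. u2 z - v2 z"] ballI conjI)
      (use u v in \<open>auto simp: linL_diff intro!: has_vector_derivative_diff\<close>)
qed

lemma freq_ball_scaleR:
  assumes "\<zeta>h \<in> freq_sphere dn" "0 \<le> \<rho>" "\<rho> \<le> \<rho>1"
  shows "\<rho> *\<^sub>R \<zeta>h \<in> freq_ball dn \<rho>1"
proof -
  obtain \<tau> \<gamma> \<eta> where \<zeta>h: "\<zeta>h = (\<tau>, \<gamma>, \<eta>)" by (metis prod.collapse)
  have "norm (\<rho> *\<^sub>R \<zeta>h) = \<rho>"
    using assms unfolding norm_scaleR by (auto simp: freq_sphere_def)
  then have "norm (\<rho> * \<tau>, \<rho> * \<gamma>, \<rho> *\<^sub>R \<eta>) \<le> \<rho>1"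
    using assms(3) by (simp add: \<zeta>h)
  then show ?thesis using assms by (auto simp: freq_sphere_def freq_ball_def \<zeta>h)
qed

lemma Rvec_eq:
  assumes "0 < \<rho>"
    and u1: "((\<lambda>z. Rf \<sigma> z q (\<rho> *\<^sub>R \<zeta>h)) has_vector_derivative u1) (at 0 within half_line \<sigma>)"
  shows "complex_of_real \<rho> *s Rvec Rf \<sigma> q \<zeta>h \<rho> = join (Rf \<sigma> 0 q (\<rho> *\<^sub>R \<zeta>h)) u1"
proof -
  have "vector_derivative (\<lambda>z. Rcheck Rf \<sigma> z q \<zeta>h \<rho>) (at 0 within half_line \<sigma>) = (1 / \<rho>) *\<^sub>R u1"
    using assms(1) unfolding Rcheck_def
    by (simp add: vector_derivative_within at_within_half_line_nontrivial
        bounded_linear.has_vector_derivative[OF bounded_linear_scaleR_right u1])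
  then have "Rvec Rf \<sigma> q \<zeta>h \<rho> = join ((1 / \<rho>) *\<^sub>R Rf \<sigma> 0 q (\<rho> *\<^sub>R \<zeta>h)) ((1 / \<rho>) *\<^sub>R u1)"
    using assms(1) by (simp add: Rvec_def Rcheck_def)
  then show ?thesis
    using assms(1)
    by (simp add: join_def vec_eq_iff scaleR_conv_of_real[where 'a = complex] split: sum.split)
qed

text \<open>Both \<open>W'\<close> and the corrector solve $\mathcal L u = \mathcal L_1$ and are bounded, so their
  difference is one of the solutions whose Cauchy data form \<open>E_side\<close>. This vector carries the
  translation mode, and makes the standard Evans function vanish as \<open>\<rho>\<close> tends to \<open>0\<close>.\<close>

lemma profile_minus_corrector_in_E_side:
  fixes A :: "'d::finite \<Rightarrow> real^'n::finite \<Rightarrow> real^'n^'n"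
  assumes sys: "hyperbolic_system A Ustar Us"
    and corr: "corrector A dn wb CB W \<rho>1 Rf"
    and W: "\<And>z. W z (p, s, h) \<in> Ustar"
    and w1: "\<And>z. ((\<lambda>z. W z (p, s, h)) has_vector_derivative w1 z) (at z)"
    and w2: "\<And>z. (w1 has_vector_derivative w2 z) (at z)"
    and ode: "\<And>z. (1 + (norm h)\<^sup>2) *\<^sub>R w2 z = calA A dn (W z (p, s, h)) s h *v w1 z"
    and bd: "bounded (w1 ` half_line \<sigma>)"
    and q: "(p, s, h) \<in> CB" and \<zeta>h: "\<zeta>h \<in> freq_sphere dn" and \<rho>: "0 < \<rho>" "\<rho> \<le> \<rho>1"
  shows "join (cvec (w1 0)) (cvec (w2 0)) - complex_of_real \<rho> *s Rvec Rf \<sigma> (p, s, h) \<zeta>h \<rho>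
    \<in> E_side A dn W \<sigma> (p, s, h) \<zeta>h \<rho>"
proof -
  let ?q = "(p, s, h)" and ?\<zeta> = "\<rho> *\<^sub>R \<zeta>h"
  have \<zeta>: "?\<zeta> \<in> freq_ball dn \<rho>1" using \<zeta>h \<rho> by (intro freq_ball_scaleR) auto
  have c: "(\<exists>C. \<exists>\<kappa>>0. \<forall>z\<in>half_line \<sigma>. norm (Rf \<sigma> z ?q ?\<zeta>) \<le> C * exp (- \<kappa> * \<bar>z\<bar>)) \<and>
      (\<exists>u1. linL_solution A dn W ?q ?\<zeta> \<sigma> (linL1 A dn (\<lambda>y. W y ?q) h ?\<zeta>) (\<lambda>z. Rf \<sigma> z ?q ?\<zeta>) u1)"
    using corr[unfolded corrector_def, THEN conjunct2, THEN spec[of _ \<sigma>], THEN conjunct2,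
        THEN conjunct1, THEN bspec, OF q, THEN bspec, OF \<zeta>] by simp
  obtain C \<kappa> where C: "\<kappa> > 0" "\<forall>z\<in>half_line \<sigma>. norm (Rf \<sigma> z ?q ?\<zeta>) \<le> C * exp (- \<kappa> * \<bar>z\<bar>)"
    using c by blast
  obtain u1 where u1: "linL_solution A dn W ?q ?\<zeta> \<sigma> (linL1 A dn (\<lambda>y. W y ?q) h ?\<zeta>) (\<lambda>z. Rf \<sigma> z ?q ?\<zeta>) u1"
    using c by blast
  have R: "complex_of_real \<rho> *s Rvec Rf \<sigma> ?q \<zeta>h \<rho> = join (Rf \<sigma> 0 ?q ?\<zeta>) (u1 0)"
    using u1 \<rho>(1) unfolding linL_solution_def by (intro Rvec_eq) auto
  have sol: "linL_solution A dn W ?q ?\<zeta> \<sigma> (\<lambda>_. 0)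
      (\<lambda>z. cvec (w1 z) - Rf \<sigma> z ?q ?\<zeta>) (\<lambda>z. cvec (w2 z) - u1 z)"
    by (rule linL_solution_diff[OF profile_derivative_solves[where W = W, OF sys W w1 w2 ode] u1])
  have "bounded ((\<lambda>z. Rf \<sigma> z ?q ?\<zeta>) ` half_line \<sigma>)"
  proof (unfold bounded_iff, intro exI ballI, elim imageE, simp only:)
    fix z assume z: "z \<in> half_line \<sigma>"
    have "norm (Rf \<sigma> z ?q ?\<zeta>) \<le> C * exp (- \<kappa> * \<bar>z\<bar>)" using C(2) z by blast
    also have "\<dots> \<le> \<bar>C\<bar> * 1"
      using C(1) by (intro mult_mono) auto
    finally show "norm (Rf \<sigma> z ?q ?\<zeta>) \<le> \<bar>C\<bar>" by simp
  qed
  moreover have "bounded ((\<lambda>z. cvec (w1 z)) ` half_line \<sigma>)"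
    using bounded_linear_image[OF bd bounded_linear_cvec] by (simp add: image_image)
  ultimately have "bounded ((\<lambda>z. cvec (w1 z) - Rf \<sigma> z ?q ?\<zeta>) ` half_line \<sigma>)"
    by (rule bounded_minus_comp[rotated])
  moreover have "join (cvec (w1 0)) (cvec (w2 0)) - join (Rf \<sigma> 0 ?q ?\<zeta>) (u1 0) =
      join (cvec (w1 0) - Rf \<sigma> 0 ?q ?\<zeta>) (cvec (w2 0) - u1 0)"
    by (simp add: join_def vec_eq_iff split: sum.split)
  ultimately show ?thesis
    unfolding E_side_def R using sol by (intro CollectI exI conjI) auto
qed

section \<open>The algebraic relation between the Evans functions\<close>

text \<open>Right inverses of the two surjections below, chosen to be independent of the frequency and of the
  correctors; for this the second one uses no vector with \<open>\<phi> \<noteq> 0\<close>. The vector \<open>l'\<close> is meant to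
  satisfy \<open>l \<cdot> l' = 1\<close>.\<close>

definition std_complement :: "'m::finite \<Rightarrow> complex^('m + 'm)" where
  "std_complement i = join (- axis i 1) 0"

definition mod_complement :: "complex^'m::finite \<Rightarrow> ('m + unit) \<Rightarrow> complex^(('m + unit) + 'm)" where
  "mod_complement l' j = (case j of Inl i \<Rightarrow> triple (- axis i 1) 0 0 | Inr _ \<Rightarrow> triple l' l' 0)"

definition jump :: "complex^('m::finite + 'm) \<Rightarrow> complex^'m" where
  "jump v = (\<chi> i. v $ Inr i - v $ Inl i)"

definition mod_jump :: "complex^'m \<Rightarrow> complex^'m \<Rightarrow> complex^(('m::finite + unit) + 'm) \<Rightarrow> complex^('m + unit)" where
  "mod_jump r l v = (\<chi> j. case j of
      Inl i \<Rightarrow> v $ Inr i - v $ Inl (Inl i) - v $ Inl (Inr ()) * r $ i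
    | Inr _ \<Rightarrow> (\<Sum>i\<in>UNIV. l $ i * v $ Inr i))"

lemma linear_jump: "Vector_Spaces.linear (*s) (*s) jump"
  by unfold_locales (auto simp: jump_def vec_eq_iff algebra_simps)

lemma linear_mod_jump: "Vector_Spaces.linear (*s) (*s) (mod_jump r l)"
  by unfold_locales
    (auto simp: mod_jump_def vec_eq_iff algebra_simps sum.distrib sum_distrib_left split: sum.split)

lemma jump_std_complement: "jump (std_complement i) = axis i 1"
  by (simp add: jump_def std_complement_def join_def vec_eq_iff)

lemma mod_jump_complement:
  assumes "(\<Sum>i\<in>UNIV. l $ i * l' $ i) = 1"
  shows "mod_jump r l (mod_complement l' j) = axis j 1"
  using assms
  by (auto simp: mod_jump_def mod_complement_def triple_def join_def vec_eq_iff axis_def split: sum.split)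

lemma kernel_jump: "{v :: complex^('m::finite + 'm). jump v = 0} = diagonal"
proof (intro set_eqI iffI; clarsimp)
  fix v :: "complex^('m::finite + 'm)" assume "jump v = 0"
  then have "v = join (\<chi> i. v $ Inl i) (\<chi> i. v $ Inl i)"
    by (auto simp: jump_def join_def vec_eq_iff split: sum.split)
  then show "v \<in> diagonal" unfolding diagonal_def by blast
next
  fix v :: "complex^('m::finite + 'm)" assume "v \<in> diagonal"
  then show "jump v = 0" by (auto simp: diagonal_def jump_def join_def vec_eq_iff)
qed

lemma kernel_mod_jump:
  fixes r l :: "complex^'m::finite"
  shows "{v. mod_jump r l v = 0} =
    {triple Vm Vp \<phi> | Vm Vp \<phi>. Vp - Vm = \<phi> *s r \<and> (\<Sum>i\<in>UNIV. l $ i * Vp $ i) = 0}"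
proof (intro set_eqI iffI; clarsimp)
  fix v :: "complex^(('m + unit) + 'm)" assume 0: "mod_jump r l v = 0"
  let ?m = "\<chi> i. v $ Inl (Inl i)" and ?p = "\<chi> i. v $ Inr i" and ?\<phi> = "v $ Inl (Inr ())"
  have "v = triple ?m ?p ?\<phi>"
    by (auto simp: triple_def join_def vec_eq_iff split: sum.split)
  moreover have "v $ Inr i - v $ Inl (Inl i) - ?\<phi> * r $ i = 0" for i
    using arg_cong[OF 0, of "\<lambda>v. v $ Inl i"] by (simp add: mod_jump_def)
  then have "?p - ?m = ?\<phi> *s r" by (simp add: vec_eq_iff)
  moreover have "(\<Sum>i\<in>UNIV. l $ i * v $ Inr i) = 0"
    using arg_cong[OF 0, of "\<lambda>v. v $ Inr ()"] by (simp add: mod_jump_def)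
  ultimately show "\<exists>Vm Vp \<phi>. v = triple Vm Vp \<phi> \<and> Vp - Vm = \<phi> *s r \<and> (\<Sum>i\<in>UNIV. l $ i * Vp $ i) = 0"
    by (intro exI[of _ ?m] exI[of _ ?p] exI[of _ ?\<phi>]) simp
next
  fix Vm Vp :: "complex^'m" and \<phi>
  assume *: "Vp - Vm = \<phi> *s r" "(\<Sum>i\<in>UNIV. l $ i * Vp $ i) = 0"
  have "Vp $ i - Vm $ i = \<phi> * r $ i" for i
    using arg_cong[OF *(1), of "\<lambda>v. v $ i"] by simp
  with *(2) show "mod_jump r l (triple Vm Vp \<phi>) = 0"
    by (auto simp: mod_jump_def triple_def join_def vec_eq_iff split: sum.split)
qed

text \<open>The exact relation between the two Evans functions. The vector in the span of \<open>b\<close> has jump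
  \<open>\<rho> (rm - rp)\<close>, which is what the column operations in the bordered matrix require.\<close>

lemma det_pair_std_vs_mod:
  fixes b :: "'m::finite \<Rightarrow> complex^('m + 'm)" and v rm rp l l' :: "complex^'m"
  assumes D: "orthonormal_basis d diagonal"
    and G: "orthonormal_basis g {triple Vm Vp \<phi> | Vm Vp \<phi>.
      Vp - Vm = \<phi> *s (rm - rp) \<and> (\<Sum>i\<in>UNIV. l $ i * Vp $ i) = 0}"
    and l': "(\<Sum>i\<in>UNIV. l $ i * l' $ i) = 1"
    and e: "join (v - \<rho> *s rm) (v - \<rho> *s rp) \<in> vec.span (range b)"
  shows "det_pair b d * det_pair (mod_complement l') g * (\<Sum>i\<in>UNIV. l $ i * (v - \<rho> *s rp) $ i) =
    \<rho> * det_pair std_complement d * det_pair (add_scalar b) g"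
proof -
  let ?r = "rm - rp"
  define Y where "Y = (\<chi> i k. jump (b k) $ i)"
  define M where "M = (\<chi> i k. mod_jump ?r l (add_scalar b k) $ i)"
  have 1: "det_pair b d = det_pair std_complement d * det Y"
    unfolding Y_def
    by (rule det_pair_eq_det_image[OF linear_jump jump_std_complement])
      (use D in \<open>simp add: orthonormal_basis_def kernel_jump\<close>)
  have 2: "det_pair (add_scalar b) g = det_pair (mod_complement l') g * det M"
    unfolding M_def
    by (rule det_pair_eq_det_image[OF linear_mod_jump mod_jump_complement[OF l']])
      (use G in \<open>simp add: orthonormal_basis_def kernel_mod_jump\<close>)
  obtain x where x: "join (v - \<rho> *s rm) (v - \<rho> *s rp) = (\<Sum>k\<in>UNIV. x k *s b k)"
    using vec_span_range[OF e] by blast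
  have xr: "(\<Sum>k\<in>UNIV. x k * b k $ Inr i) = v $ i - \<rho> * rp $ i" for i
    using arg_cong[OF x, of "\<lambda>v. v $ Inr i"] by (simp add: join_def)
  have xl: "(\<Sum>k\<in>UNIV. x k * b k $ Inl i) = v $ i - \<rho> * rm $ i" for i
    using arg_cong[OF x, of "\<lambda>v. v $ Inl i"] by (simp add: join_def)
  define lb where "lb = (\<chi> k. \<Sum>i\<in>UNIV. l $ i * b k $ Inr i)"
  have Yx: "Y *v (\<chi> k. x k) = \<rho> *s ?r"
  proof -
    have "(Y *v (\<chi> k. x k)) $ i = \<rho> * (rm $ i - rp $ i)" for i
    proof -
      have "(Y *v (\<chi> k. x k)) $ i = (\<Sum>k\<in>UNIV. x k * b k $ Inr i) - (\<Sum>k\<in>UNIV. x k * b k $ Inl i)"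
        by (simp add: Y_def jump_def matrix_vector_mult_def algebra_simps sum_subtractf)
      also have "\<dots> = \<rho> * (rm $ i - rp $ i)" unfolding xr xl by (simp add: algebra_simps)
      finally show ?thesis .
    qed
    then show ?thesis by (simp add: vec_eq_iff right_diff_distrib)
  qed
  have "M = (\<chi> i j. case j of
        Inl k \<Rightarrow> (case i of Inl i \<Rightarrow> Y $ i $ k | Inr (_::unit) \<Rightarrow> lb $ k)
      | Inr (_::unit) \<Rightarrow> (case i of Inl i \<Rightarrow> - ?r $ i | Inr _ \<Rightarrow> 0))"
    by (auto simp: M_def Y_def lb_def mod_jump_def jump_def add_scalar_def triple_def join_def vec_eq_iff
        split: sum.split)
  then have "\<rho> * det M = det Y * (\<Sum>k\<in>UNIV. lb $ k * (\<chi> k. x k) $ k)"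
    using det_bordered[OF Yx, of lb] by simp
  also have "(\<Sum>k\<in>UNIV. lb $ k * (\<chi> k. x k) $ k) = (\<Sum>i\<in>UNIV. l $ i * (\<Sum>k\<in>UNIV. x k * b k $ Inr i))"
  proof -
    have "(\<Sum>k\<in>UNIV. lb $ k * (\<chi> k. x k) $ k) = (\<Sum>k\<in>UNIV. \<Sum>i\<in>UNIV. l $ i * (x k * b k $ Inr i))"
      by (simp add: lb_def sum_distrib_left sum_distrib_right mult_ac)
    also have "\<dots> = (\<Sum>i\<in>UNIV. l $ i * (\<Sum>k\<in>UNIV. x k * b k $ Inr i))"
      by (subst sum.swap) (simp add: sum_distrib_left)
    finally show ?thesis .
  qed
  finally have 3: "\<rho> * det M = det Y * (\<Sum>i\<in>UNIV. l $ i * (v - \<rho> *s rp) $ i)"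
    by (simp add: xr)
  show ?thesis
    unfolding 1 2 using 3 by (metis (no_types, lifting) mult.assoc mult.left_commute)
qed

section \<open>Smoothness and size of the factor\<close>

lemma cmod_det_pair_le:
  fixes b :: "'b::finite \<Rightarrow> complex^('b + 'c::finite)"
  assumes "\<And>j i. cmod (b j $ i) \<le> B" "\<And>j i. cmod (c j $ i) \<le> B"
  shows "cmod (det_pair b c) \<le> fact CARD('b + 'c) * B ^ CARD('b + 'c)"
  unfolding det_pair_def by (rule cmod_det_le) (use assms in \<open>auto split: sum.split\<close>)

text \<open>The product of \<open>w\<^sub>z(0)\<close> with the value at \<open>0\<close> of \<open>W' - R\<^sub>+\<close>, at the frequency \<open>\<rho>\<close> times \<open>(\<tau>, \<gamma>, \<eta>)\<close>,
  as given by the normalization of the corrector; \<open>m\<close> stands for \<open>w\<^sub>z(0) \<cdot> W\<^sub>z(0, q)\<close>.\<close>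

definition normal_component :: "real \<Rightarrow> real \<times> real \<times> (real^'d) \<Rightarrow> real \<Rightarrow> complex" where
  "normal_component m = (\<lambda>(\<tau>, \<gamma>, \<eta>) \<rho>. complex_of_real m + complex_of_real \<rho> * (\<i> * complex_of_real \<tau> + complex_of_real \<gamma>) +
     complex_of_real (\<rho>\<^sup>2 * (norm \<eta>)\<^sup>2))"

lemma Re_normal_component_ge:
  assumes "\<zeta>h \<in> freq_sphere dn" "0 \<le> \<rho>"
  shows "m \<le> Re (normal_component m \<zeta>h \<rho>)"
  using assms by (auto simp: normal_component_def freq_sphere_def)

lemma cmod_normal_component_le:
  assumes "\<zeta>h \<in> freq_sphere dn" "0 \<le> \<rho>" "\<rho> \<le> \<rho>1"
  shows "cmod (normal_component m \<zeta>h \<rho>) \<le> \<bar>m\<bar> + \<rho>1 * 2 + \<rho>1\<^sup>2"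
proof -
  obtain \<tau> \<gamma> \<eta> where \<zeta>h: "\<zeta>h = (\<tau>, \<gamma>, \<eta>)" by (metis prod.collapse)
  have n: "norm (\<tau>, \<gamma>, \<eta>) = 1" using assms(1) by (simp add: freq_sphere_def \<zeta>h)
  have "norm \<tau> \<le> norm (\<tau>, \<gamma>, \<eta>)" using norm_fst_le[of \<tau> "(\<gamma>, \<eta>)"] by simp
  then have \<tau>: "\<bar>\<tau>\<bar> \<le> 1" using n by simp
  have s: "norm (\<gamma>, \<eta>) \<le> 1" using norm_snd_le[of "(\<gamma>, \<eta>)" \<tau>] n by simp
  have \<gamma>: "\<bar>\<gamma>\<bar> \<le> 1" using norm_fst_le[of \<gamma> \<eta>] s by simp
  have "norm \<eta> \<le> 1" using norm_snd_le[of \<eta> \<gamma>] s by simp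
  then have \<eta>: "(norm \<eta>)\<^sup>2 \<le> 1" by (simp add: power_le_one)
  have "cmod (\<i> * complex_of_real \<tau> + complex_of_real \<gamma>) \<le> 2"
    using norm_triangle_ineq[of "\<i> * complex_of_real \<tau>" "complex_of_real \<gamma>"] \<tau> \<gamma>
    by (simp add: norm_mult)
  then have 1: "cmod (complex_of_real \<rho> * (\<i> * complex_of_real \<tau> + complex_of_real \<gamma>)) \<le> \<rho>1 * 2"
    unfolding norm_mult using assms by (intro mult_mono) auto
  have "\<rho>\<^sup>2 * (norm \<eta>)\<^sup>2 \<le> \<rho>1\<^sup>2 * 1"
    using assms \<eta> by (intro mult_mono power_mono) auto
  then have 2: "cmod (complex_of_real (\<rho>\<^sup>2 * (norm \<eta>)\<^sup>2)) \<le> \<rho>1\<^sup>2"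
    unfolding norm_of_real by simp
  show ?thesis
    unfolding normal_component_def \<zeta>h split
    by (rule norm_triangle_le, rule add_mono[OF norm_triangle_le[OF add_mono] 2]) (use 1 in auto)
qed

lemma smooth_on_normal_component:
  fixes m :: "'q::euclidean_space \<Rightarrow> real"
  assumes "smooth_on C m"
  shows "smooth_on (C \<times> (X :: (real \<times> real \<times> (real^'d::finite)) set) \<times> Y)
    (\<lambda>(q, \<zeta>h, \<rho>). normal_component (m q) \<zeta>h \<rho>)"
proof -
  let ?S = "C \<times> X \<times> Y"
  note fst = smooth_on_linear_compose[OF bounded_linear_fst] and snd = smooth_on_linear_compose[OF bounded_linear_snd]
  note of_real = smooth_on_linear_compose[OF bounded_linear_of_real]
  have id: "smooth_on ?S (\<lambda>x. x)" by (rule smooth_on_linear[OF bounded_linear_ident])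
  have m: "smooth_on ?S (\<lambda>x. m (fst x))"
    by (rule smooth_on_compose[OF assms fst[OF id]]) auto
  have "smooth_on ?S (\<lambda>x. complex_of_real (m (fst x)) +
      complex_of_real (snd (snd x)) * (\<i> * complex_of_real (fst (fst (snd x))) + complex_of_real (fst (snd (fst (snd x))))) +
      complex_of_real (snd (snd x) * snd (snd x) * (snd (snd (fst (snd x))) \<bullet> snd (snd (fst (snd x))))))"
    by (intro smooth_on_add smooth_on_mult smooth_on_const of_real m fst snd id
        smooth_on_bilinear[OF bounded_bilinear_inner])
  then show ?thesis
    by (rule smooth_on_cong[rotated])
      (auto simp: normal_component_def power2_norm_eq_inner[symmetric] power2_eq_square)
qed

lemma smooth_on_det_pair:
  fixes b :: "'b::finite \<Rightarrow> complex^('b + 'c::finite)"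
  assumes "\<And>l. smooth_on S (\<lambda>x. c x l)"
  shows "smooth_on S (\<lambda>x. det_pair b (c x))"
  unfolding det_pair_def
proof (rule smooth_on_det)
  fix i j :: "'b + 'c"
  show "smooth_on S (\<lambda>x. (\<chi> i j. case j of Inl k \<Rightarrow> b k $ i | Inr l \<Rightarrow> c x l $ i) $ i $ j)"
    using smooth_on_linear_compose[OF bounded_linear_vec_nth assms]
    by (cases j) (auto intro: smooth_on_const)
qed

lemma sphere_polar:
  assumes "\<zeta> \<in> freq_ball dn \<rho>1 - {0}"
  shows "inverse (norm \<zeta>) *\<^sub>R \<zeta> \<in> freq_sphere dn" "norm \<zeta> \<in> {0<..\<rho>1}"
proof -
  obtain \<tau> \<gamma> \<eta> where \<zeta>: "\<zeta> = (\<tau>, \<gamma>, \<eta>)" by (metis prod.collapse)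
  have *: "norm \<zeta> > 0" "norm \<zeta> \<le> \<rho>1" "\<gamma> \<ge> 0" "\<eta> $ dn = 0"
    using assms by (auto simp: freq_ball_def \<zeta>)
  have "norm (inverse (norm \<zeta>) *\<^sub>R \<zeta>) = 1" using *(1) by simp
  then have "norm (inverse (norm \<zeta>) * \<tau>, inverse (norm \<zeta>) * \<gamma>, inverse (norm \<zeta>) *\<^sub>R \<eta>) = 1"
    by (simp add: \<zeta>)
  then show "inverse (norm \<zeta>) *\<^sub>R \<zeta> \<in> freq_sphere dn"
    using * unfolding freq_sphere_def by (simp add: \<zeta>)
  show "norm \<zeta> \<in> {0<..\<rho>1}" using * by simp
qed

lemma smooth_on_polar:
  fixes f :: "'q::euclidean_space \<Rightarrow> (real \<times> real \<times> (real^'d::finite)) \<Rightarrow> real \<Rightarrow> 'b::real_normed_vector"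
  assumes "smooth_on (C \<times> freq_sphere dn \<times> {0..\<rho>1}) (\<lambda>(q, \<zeta>h, \<rho>). f q \<zeta>h \<rho>)"
  shows "smooth_on (C \<times> (freq_ball dn \<rho>1 - {0})) (\<lambda>(q, \<zeta>). f q (inverse (norm \<zeta>) *\<^sub>R \<zeta>) (norm \<zeta>))"
proof -
  let ?S = "C \<times> (freq_ball dn \<rho>1 - {0})"
  have id: "smooth_on ?S (\<lambda>x. x)" by (rule smooth_on_linear[OF bounded_linear_ident])
  have q: "smooth_on ?S fst" and \<zeta>: "smooth_on ?S snd"
    using smooth_on_linear bounded_linear_fst bounded_linear_snd by blast+
  have n: "smooth_on ?S (\<lambda>x. norm (snd x))"
    by (rule smooth_on_compose[OF smooth_on_norm \<zeta>]) auto
  have i: "smooth_on ?S (\<lambda>x. inverse (norm (snd x)))"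
    by (rule smooth_on_inverse[OF n]) auto
  have "smooth_on ?S (\<lambda>x. (fst x, inverse (norm (snd x)) *\<^sub>R snd x, norm (snd x)))"
    by (intro smooth_on_Pair q n smooth_on_bilinear[OF bounded_bilinear_scaleR] i \<zeta>)
  moreover have "(fst x, inverse (norm (snd x)) *\<^sub>R snd x, norm (snd x)) \<in> C \<times> freq_sphere dn \<times> {0..\<rho>1}"
    if "x \<in> ?S" for x
    using that sphere_polar[of "snd x" dn \<rho>1] by (auto simp: mem_Times_iff)
  ultimately have "smooth_on ?S (\<lambda>x. case (fst x, inverse (norm (snd x)) *\<^sub>R snd x, norm (snd x)) of
      (q, \<zeta>h, \<rho>) \<Rightarrow> f q \<zeta>h \<rho>)"
    by (rule smooth_on_compose[OF assms])
  then show ?thesis by (rule smooth_on_cong[rotated]) auto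
qed

text \<open>The slope of the profile at \<open>0\<close> depends smoothly on \<open>q\<close>. It is read off from the \<open>+\<close> half, whose
  argument at the matching point is \<open>zb\<close>.\<close>

lemma smooth_on_initial_slope:
  fixes A :: "'d::finite \<Rightarrow> real^'n::finite \<Rightarrow> real^'n^'n"
  assumes family: "half_profile_family A dn Ustar Us pb \<delta> isom R r \<Phi> J"
    and manifold: "profile_manifold A dn Us pb wb k \<delta> r \<Phi> J zb ab CB asol W"
  shows "smooth_on CB (\<lambda>q. vector_derivative (\<lambda>z. \<Phi> Plus z (params Plus q) (fst (asol q))) (at zb))"
proof -
  define P where "P = param_dom dn Us pb \<delta> Plus"
  define Q where "Q = amp_dom A dn pb r Plus"
  define S where "S = {(z, \<theta>, a). \<theta> \<in> P \<and> a \<in> Q \<and> z \<in> J Plus \<theta> a}"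
  have F: "(\<forall>\<theta>\<in>P. \<forall>a\<in>Q. open (J Plus \<theta> a)) \<and> smooth_on S (\<lambda>(z, \<theta>, a). \<Phi> Plus z \<theta> a)"
    using family[unfolded half_profile_family_def, THEN conjunct2, THEN conjunct2, THEN conjunct2,
        THEN spec, of Plus] unfolding S_def P_def Q_def by blast
  have "open {z. (z, y) \<in> S}" for y
  proof (cases "fst y \<in> P \<and> snd y \<in> Q")
    case True
    then have "{z. (z, y) \<in> S} = J Plus (fst y) (snd y)" by (auto simp: S_def split_beta)
    then show ?thesis using F True by auto
  next
    case False
    then have "{z. (z, y) \<in> S} = {}" by (auto simp: S_def)
    then show ?thesis by simp
  qed
  from smooth_on_partial_derivative[of S "\<lambda>z (\<theta>, a). \<Phi> Plus z \<theta> a", OF conjunct2[OF F] this]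
  have D: "smooth_on S (\<lambda>(z, y). vector_derivative (\<lambda>z. case y of (\<theta>, a) \<Rightarrow> \<Phi> Plus z \<theta> a) (at z))" .
  have asol: "smooth_on CB asol" using manifold by (simp add: profile_manifold_def)
  have par: "bounded_linear (params Plus :: ((real^'n) \<times> (real^'n)) \<times> real \<times> (real^'d) \<Rightarrow> _)"
  proof -
    have "params Plus = (\<lambda>q :: ((real^'n) \<times> (real^'n)) \<times> real \<times> (real^'d). (fst (fst q), snd q))"
      by (auto simp: params_def)
    then show ?thesis
      by (simp add: bounded_linear_Pair bounded_linear_fst_comp bounded_linear_fst bounded_linear_snd)
  qed
  have "smooth_on CB (\<lambda>q. (zb, params Plus q, fst (asol q)))"
    by (intro smooth_on_Pair smooth_on_const smooth_on_linear[OF par]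
        smooth_on_linear_compose[OF bounded_linear_fst asol])
  note C = smooth_on_compose[OF D this]
  have "(zb, params Plus q, fst (asol q)) \<in> S" if "q \<in> CB" for q
  proof -
    have *: "\<forall>\<sigma>. params \<sigma> q \<in> param_dom dn Us pb \<delta> \<sigma> \<and> side_of \<sigma> (asol q) \<in> amp_dom A dn pb r \<sigma> \<and>
         (\<forall>z\<in>half_line \<sigma>. z + sg \<sigma> * zb \<in> J \<sigma> (params \<sigma> q) (side_of \<sigma> (asol q)))"
      using manifold that unfolding profile_manifold_def by blast
    have "0 + sg Plus * zb \<in> J Plus (params Plus q) (side_of Plus (asol q))"
      using *[THEN spec[of _ Plus], THEN conjunct2, THEN conjunct2] half_line_0 by (rule bspec)
    then show ?thesis
      using *[THEN spec[of _ Plus]] by (simp add: S_def P_def Q_def)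
  qed
  from C[OF this] show ?thesis by simp
qed

section \<open>Comparison of the Evans functions\<close>

theorem theorem1p24:
  fixes A :: "'d::finite \<Rightarrow> real^'n::finite \<Rightarrow> real^'n^'n"
    and dn :: 'd
    and Ustar :: "(real^'n) set"
    and Us :: "side \<Rightarrow> (real^'n) set"
    and pb :: "side \<Rightarrow> real^'n"
    and wb :: "real \<Rightarrow> real^'n"
    and k :: nat
    and \<delta> R r zb \<rho>1 :: real
    and isom :: "side \<Rightarrow> (real^'n) \<times> real \<times> (real^'d) \<Rightarrow> real^'n \<Rightarrow> real^'n"
    and \<Phi> :: "side \<Rightarrow> real \<Rightarrow> (real^'n) \<times> real \<times> (real^'d) \<Rightarrow> real^'n \<Rightarrow> real^'n"
    and J :: "side \<Rightarrow> (real^'n) \<times> real \<times> (real^'d) \<Rightarrow> real^'n \<Rightarrow> real set"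
    and ab :: "(real^'n) \<times> (real^'n)"
    and CB :: "(((real^'n) \<times> (real^'n)) \<times> real \<times> (real^'d)) set"
    and asol :: "((real^'n) \<times> (real^'n)) \<times> real \<times> (real^'d) \<Rightarrow> (real^'n) \<times> (real^'n)"
    and W :: "real \<Rightarrow> ((real^'n) \<times> (real^'n)) \<times> real \<times> (real^'d) \<Rightarrow> real^'n"
    and Rf :: "side \<Rightarrow> real \<Rightarrow> ((real^'n) \<times> (real^'n)) \<times> real \<times> (real^'d) \<Rightarrow>
                 real \<times> real \<times> (real^'d) \<Rightarrow> complex^'n"
    and BE :: "((real^'n) \<times> (real^'n)) \<times> real \<times> (real^'d) \<Rightarrow> real \<times> real \<times> (real^'d) \<Rightarrow> real \<Rightarrow>
                 ('n + 'n) \<Rightarrow> complex^(('n + 'n) + ('n + 'n))"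
    and BD :: "('n + 'n) \<Rightarrow> complex^(('n + 'n) + ('n + 'n))"
    and BG :: "((real^'n) \<times> (real^'n)) \<times> real \<times> (real^'d) \<Rightarrow> real \<times> real \<times> (real^'d) \<Rightarrow> real \<Rightarrow>
                 ('n + 'n) \<Rightarrow> complex^((('n + 'n) + unit) + ('n + 'n))"
  assumes system: "hyperbolic_system A Ustar Us"
    and base: "base_profile A dn Ustar Us pb wb k"
    and isos: "spectral_isos A dn Us pb \<delta> isom"
    and family: "half_profile_family A dn Ustar Us pb \<delta> isom R r \<Phi> J"
    and matching: "base_match A dn pb wb r \<Phi> J zb ab"
    and manifold: "profile_manifold A dn Us pb wb k \<delta> r \<Phi> J zb ab CB asol W"
    and corr: "corrector A dn wb CB W \<rho>1 Rf"
    and basis_E: "\<And>q \<zeta>h \<rho>. q \<in> CB \<Longrightarrow> \<zeta>h \<in> freq_sphere dn \<Longrightarrow> 0 < \<rho> \<Longrightarrow> \<rho> \<le> \<rho>1 \<Longrightarrow>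
                    orthonormal_basis (BE q \<zeta>h \<rho>) (E_prod A dn W q \<zeta>h \<rho>)"
    and basis_D: "orthonormal_basis BD diagonal"
    and basis_G: "\<And>q \<zeta>h \<rho>. q \<in> CB \<Longrightarrow> \<zeta>h \<in> freq_sphere dn \<Longrightarrow> 0 \<le> \<rho> \<Longrightarrow> \<rho> \<le> \<rho>1 \<Longrightarrow>
                    orthonormal_basis (BG q \<zeta>h \<rho>) (G_mod wb Rf q \<zeta>h \<rho>)"
    and basis_G_smooth: "\<And>l. smooth_on (CB \<times> freq_sphere dn \<times> {0..\<rho>1})
                           (\<lambda>(q, \<zeta>h, \<rho>). BG q \<zeta>h \<rho> l)"
  shows "let T = {q \<in> CB. strongly_transversal A dn pb wb k r \<Phi> zb asol q} in
    \<exists>Q. open Q \<and> ((pb Plus, pb Minus), 0, 0) \<in> Q \<and>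
      (\<forall>q0 \<in> T \<inter> Q. \<exists>\<rho>0 V \<alpha> \<alpha>p c.
         0 < \<rho>0 \<and> \<rho>0 \<le> \<rho>1 \<and> open V \<and> q0 \<in> V \<and> 0 < c \<and>
         smooth_on ((T \<inter> V) \<times> (freq_ball dn \<rho>0 - {0})) (\<lambda>(q, \<zeta>). \<alpha> q \<zeta> :: complex) \<and>
         smooth_on ((T \<inter> V) \<times> freq_sphere dn \<times> {0..\<rho>0}) (\<lambda>(q, \<zeta>h, \<rho>). \<alpha>p q \<zeta>h \<rho>) \<and>
         (\<forall>q \<in> T \<inter> V.
            (\<forall>\<zeta>h \<in> freq_sphere dn. \<forall>\<rho> \<in> {0<..\<rho>0}.
               \<alpha> q (\<rho> *\<^sub>R \<zeta>h) = \<alpha>p q \<zeta>h \<rho> \<and> c \<le> cmod (\<alpha> q (\<rho> *\<^sub>R \<zeta>h))) \<and>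
            (\<exists>C. \<forall>\<zeta>h \<in> freq_sphere dn. \<forall>\<rho> \<in> {0<..\<rho>0}.
               cmod (D_std BE BD q \<zeta>h \<rho> - complex_of_real \<rho> * \<alpha> q (\<rho> *\<^sub>R \<zeta>h) * D_mod BE BG q \<zeta>h \<rho>)
                 \<le> C * \<rho>\<^sup>2)))"
proof -
  let ?wz = "vector_derivative wb (at 0)" and ?qb = "((pb Plus, pb Minus), 0, 0)"
  define \<omega> where "\<omega> q = vector_derivative (\<lambda>z. \<Phi> Plus z (params Plus q) (fst (asol q))) (at zb)" for q
  define m where "m q = ?wz \<bullet> \<omega> q" for q
  have qb: "?qb \<in> CB" using manifold by (simp add: profile_manifold_def)
  have \<rho>1: "0 < \<rho>1" using corr by (simp add: corrector_def)
  have norml: "(\<Sum>i\<in>UNIV. cvec ?wz $ i * Rf \<sigma> 0 q (\<tau>, \<gamma>, \<eta>) $ i) =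
      - (\<i> * complex_of_real \<tau> + complex_of_real \<gamma> + complex_of_real ((norm \<eta>)\<^sup>2))"
    if "q \<in> CB" "(\<tau>, \<gamma>, \<eta>) \<in> freq_ball dn \<rho>1" for \<sigma> q \<tau> \<gamma> \<eta>
    using corr[unfolded corrector_def, THEN conjunct2, THEN spec[of _ \<sigma>], THEN conjunct2,
        THEN conjunct1, THEN bspec, OF that(1), THEN bspec, OF that(2)] by simp
  \<comment> \<open>At the frequency \<open>(0, \<rho>1, 0)\<close> the normalization equates a product with \<open>w\<^sub>z(0)\<close> to \<open>-\<rho>1\<close>.\<close>
  have wz: "?wz \<noteq> 0"
  proof
    assume "?wz = 0"
    then have "cvec ?wz = 0" by (simp add: vec_eq_iff)
    moreover have "(0, \<rho>1, 0) \<in> freq_ball dn \<rho>1" using \<rho>1 by (simp add: freq_ball_def norm_Pair)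
    ultimately show False using norml[OF qb, of 0 \<rho>1 0 Plus] \<rho>1 by simp
  qed
  have m_smooth: "smooth_on CB m"
    unfolding m_def[abs_def] \<omega>_def
    by (rule smooth_on_linear_compose[OF bounded_linear_inner_right smooth_on_initial_slope[OF family manifold]])
  \<comment> \<open>The base profile is the profile of the base point.\<close>
  have "\<omega> ?qb = ?wz"
  proof -
    obtain w1 w2 where w1: "\<And>z. ((\<lambda>z. W z ?qb) has_vector_derivative w1 z) (at z)" "w1 0 = \<omega> ?qb"
      by (rule profile_derivatives[OF family manifold qb refl, folded \<omega>_def], rule that)
    have "W z ?qb = wb z" for z
    proof -
      obtain \<sigma> where z: "z \<in> half_line \<sigma>"
        by (cases "z \<ge> 0") (auto simp: half_line_def intro: that[of Plus] that[of Minus])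
      have p: "params \<sigma> ?qb = (pb \<sigma>, 0, 0)" by (cases \<sigma>) (simp_all add: params_def)
      have ab: "asol ?qb = ab" using manifold by (simp add: profile_manifold_def)
      have "\<forall>\<sigma>. \<forall>z\<in>half_line \<sigma>. W z ?qb = phi \<Phi> zb \<sigma> z (params \<sigma> ?qb) (side_of \<sigma> (asol ?qb))"
        using manifold qb unfolding profile_manifold_def by blast
      then have "W z ?qb = phi \<Phi> zb \<sigma> z (params \<sigma> ?qb) (side_of \<sigma> (asol ?qb))" using z by blast
      moreover have "wb z = phi \<Phi> zb \<sigma> z (pb \<sigma>, 0, 0) (side_of \<sigma> ab)"
        using matching z unfolding base_match_def by blast
      ultimately show ?thesis unfolding p ab by simp
    qed
    then have "(wb has_vector_derivative \<omega> ?qb) (at 0)" using w1(1)[of 0] w1(2) by simp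
    then show ?thesis by (simp add: vector_derivative_at)
  qed
  then have mb: "m ?qb = (norm ?wz)\<^sup>2" by (simp add: m_def power2_norm_eq_inner)
  \<comment> \<open>Positivity of \<open>m\<close> on \<open>Q\<close> makes \<open>d\<close> nonzero; the upper bound serves the lower bound for \<open>\<alpha>\<close>.\<close>
  let ?M = "2 * (norm ?wz)\<^sup>2"
  obtain Q where Q: "open Q" "?qb \<in> Q" "\<And>q. q \<in> CB \<Longrightarrow> q \<in> Q \<Longrightarrow> m q \<in> {0<..<?M}"
  proof -
    have "m ?qb \<in> {0<..<?M}" using wz by (simp add: mb)
    then show thesis
      using smooth_on_imp_continuous_on[OF m_smooth] qb that
      unfolding continuous_on_topological by (metis open_greaterThanLessThan)
  qed
  define l :: "complex^('n + 'n)" where "l = join (cvec ?wz) 0"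
  define l' where "l' = complex_of_real (1 / (norm ?wz)\<^sup>2) *s l"
  have l_sum: "(\<Sum>i\<in>UNIV. l $ i * x $ i) = (\<Sum>i\<in>UNIV. cvec ?wz $ i * x $ Inl i)" for x
    by (simp add: l_def join_def UNIV_sum_split)
  have l': "(\<Sum>i\<in>UNIV. l $ i * l' $ i) = 1"
  proof -
    have "(\<Sum>i\<in>UNIV. l $ i * l' $ i) = complex_of_real (\<Sum>i\<in>UNIV. ?wz $ i * (1 / (norm ?wz)\<^sup>2 * ?wz $ i))"
      unfolding l_sum by (simp add: l'_def l_def join_def)
    also have "(\<Sum>i\<in>UNIV. ?wz $ i * (1 / (norm ?wz)\<^sup>2 * ?wz $ i)) = (?wz \<bullet> ?wz) / (norm ?wz)\<^sup>2"
      by (simp add: inner_vec_def sum_divide_distrib)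
    also have "\<dots> = 1" using wz by (simp add: power2_norm_eq_inner)
    finally show ?thesis by simp
  qed
  have Gker: "G_mod wb Rf q \<zeta>h \<rho> = {v. mod_jump (Rvec Rf Minus q \<zeta>h \<rho> - Rvec Rf Plus q \<zeta>h \<rho>) l v = 0}" for q \<zeta>h \<rho>
    unfolding kernel_mod_jump G_mod_def l_def ..
  define c0 where "c0 = det_pair std_complement BD"
  have c0: "c0 \<noteq> 0"
    unfolding c0_def
    by (rule det_pair_complement_nonzero[OF linear_jump jump_std_complement])
      (use basis_D in \<open>simp add: kernel_jump\<close>)
  define g where "g q \<zeta>h \<rho> = det_pair (mod_complement l') (BG q \<zeta>h \<rho>)" for q \<zeta>h \<rho>
  have g: "g q \<zeta>h \<rho> \<noteq> 0" if "q \<in> CB" "\<zeta>h \<in> freq_sphere dn" "0 \<le> \<rho>" "\<rho> \<le> \<rho>1" for q \<zeta>h \<rho>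
    unfolding g_def
    by (rule det_pair_complement_nonzero[OF linear_mod_jump mod_jump_complement[OF l']])
      (use basis_G[OF that] in \<open>simp add: Gker\<close>)
  \<comment> \<open>All columns of the matrix of \<open>g\<close> are constant or unit vectors, so \<open>B\<close> bounds its entries.\<close>
  define B where "B = 1 + (\<Sum>j\<in>UNIV. \<Sum>i\<in>UNIV. cmod (mod_complement l' j $ i))"
  define K where "K = fact CARD((('n + 'n) + unit) + ('n + 'n)) * B ^ CARD((('n + 'n) + unit) + ('n + 'n))"
  have B: "B \<ge> 1" unfolding B_def by (simp add: sum_nonneg)
  then have K: "K > 0" unfolding K_def by simp
  have gK: "cmod (g q \<zeta>h \<rho>) \<le> K" if "q \<in> CB" "\<zeta>h \<in> freq_sphere dn" "0 \<le> \<rho>" "\<rho> \<le> \<rho>1" for q \<zeta>h \<rho>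
    unfolding g_def K_def
  proof (rule cmod_det_pair_le)
    fix j i
    have "cmod (mod_complement l' j $ i) \<le> (\<Sum>i\<in>UNIV. cmod (mod_complement l' j $ i))"
      by (rule member_le_sum) auto
    also have "\<dots> \<le> (\<Sum>j\<in>UNIV. \<Sum>i\<in>UNIV. cmod (mod_complement l' j $ i))"
      by (rule member_le_sum[of j UNIV "\<lambda>j. \<Sum>i\<in>UNIV. cmod (mod_complement l' j $ i)"]) (auto intro: sum_nonneg)
    finally show "cmod (mod_complement l' j $ i) \<le> B" by (simp add: B_def)
  next
    fix j i
    show "cmod (BG q \<zeta>h \<rho> j $ i) \<le> B"
      using orthonormal_entry_le_1[OF basis_G[OF that]] B by (rule order_trans)
  qed
  define d where "d q \<zeta>h \<rho> = normal_component (m q) \<zeta>h \<rho>" for q and \<zeta>h :: "real \<times> real \<times> (real^'d)" and \<rho>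
  have d: "d q \<zeta>h \<rho> \<noteq> 0" if "q \<in> CB \<inter> Q" "\<zeta>h \<in> freq_sphere dn" "0 \<le> \<rho>" for q \<zeta>h \<rho>
    using Re_normal_component_ge[OF that(2,3), of "m q"] Q(3)[of q] that(1)
    by (auto simp: d_def complex_eq_iff)
  \<comment> \<open>The upper bounds for \<open>g\<close> and \<open>d\<close> give the lower bound for \<open>\<alpha>\<close>.\<close>
  let ?Dm = "?M + \<rho>1 * 2 + \<rho>1\<^sup>2"
  have dD: "cmod (d q \<zeta>h \<rho>) \<le> ?Dm" if "q \<in> CB \<inter> Q" "\<zeta>h \<in> freq_sphere dn" "0 \<le> \<rho>" "\<rho> \<le> \<rho>1" for q \<zeta>h \<rho>
    using cmod_normal_component_le[OF that(2-4), of "m q"] Q(3)[of q] that(1) by (auto simp: d_def)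
  define \<alpha>p where "\<alpha>p q \<zeta>h \<rho> = c0 * inverse (g q \<zeta>h \<rho> * d q \<zeta>h \<rho>)" for q \<zeta>h \<rho>
  \<comment> \<open>Polar coordinates turn \<open>\<alpha>p\<close> into a function of the frequency, smooth off the origin.\<close>
  define \<alpha> where "\<alpha> q \<zeta> = \<alpha>p q (inverse (norm \<zeta>) *\<^sub>R \<zeta>) (norm \<zeta>)" for q \<zeta>
  have \<alpha>: "\<alpha> q (\<rho> *\<^sub>R \<zeta>h) = \<alpha>p q \<zeta>h \<rho>" if "\<zeta>h \<in> freq_sphere dn" "0 < \<rho>" for q \<zeta>h \<rho>
  proof -
    have "norm \<zeta>h = 1" using that(1) by (auto simp: freq_sphere_def)
    then have "norm (\<rho> *\<^sub>R \<zeta>h) = \<rho>" using that(2) by simp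
    then show ?thesis unfolding \<alpha>_def using that(2) by simp
  qed
  define c where "c = cmod c0 / (K * ?Dm)"
  have Dm: "?Dm > 0" using \<rho>1 by (simp add: add_nonneg_pos)
  have cpos: "c > 0" using c0 K Dm by (simp add: c_def)
  have c_le: "c \<le> cmod (\<alpha>p q \<zeta>h \<rho>)" if "q \<in> CB \<inter> Q" "\<zeta>h \<in> freq_sphere dn" "0 \<le> \<rho>" "\<rho> \<le> \<rho>1" for q \<zeta>h \<rho>
  proof -
    have "cmod (g q \<zeta>h \<rho> * d q \<zeta>h \<rho>) \<le> K * ?Dm"
      unfolding norm_mult using gK[of q \<zeta>h \<rho>] dD[OF that] that K by (intro mult_mono) auto
    moreover have "cmod (g q \<zeta>h \<rho> * d q \<zeta>h \<rho>) > 0"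
      using g[of q \<zeta>h \<rho>] d[OF that(1-3)] that by simp
    ultimately have "cmod c0 / (K * ?Dm) \<le> cmod c0 / cmod (g q \<zeta>h \<rho> * d q \<zeta>h \<rho>)"
      by (intro divide_left_mono) (use K Dm in auto)
    then show ?thesis by (simp add: c_def \<alpha>p_def norm_mult norm_inverse divide_inverse)
  qed
  have \<alpha>p_smooth: "smooth_on ((CB \<inter> Q) \<times> freq_sphere dn \<times> {0..\<rho>1}) (\<lambda>(q, \<zeta>h, \<rho>). \<alpha>p q \<zeta>h \<rho>)"
  proof -
    let ?S = "(CB \<inter> Q) \<times> freq_sphere dn \<times> {0..\<rho>1}"
    have "smooth_on ?S (\<lambda>x. det_pair (mod_complement l') (\<lambda>l. case x of (q, \<zeta>h, \<rho>) \<Rightarrow> BG q \<zeta>h \<rho> l))"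
      by (intro smooth_on_det_pair smooth_on_subset[OF basis_G_smooth]) auto
    then have gs: "smooth_on ?S (\<lambda>(q, \<zeta>h, \<rho>). g q \<zeta>h \<rho>)"
      by (rule smooth_on_cong[rotated]) (auto simp: g_def)
    have ds: "smooth_on ?S (\<lambda>(q, \<zeta>h, \<rho>). d q \<zeta>h \<rho>)"
      unfolding d_def by (rule smooth_on_normal_component[OF smooth_on_subset[OF m_smooth]]) simp
    have "smooth_on ?S (\<lambda>x. c0 * inverse ((case x of (q, \<zeta>h, \<rho>) \<Rightarrow> g q \<zeta>h \<rho>) * (case x of (q, \<zeta>h, \<rho>) \<Rightarrow> d q \<zeta>h \<rho>)))"
      by (intro smooth_on_mult smooth_on_const smooth_on_inverse gs ds) (use g d in auto)
    then show ?thesis by (rule smooth_on_cong[rotated]) (auto simp: \<alpha>p_def)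
  qed
  have \<alpha>_smooth: "smooth_on ((CB \<inter> Q) \<times> (freq_ball dn \<rho>1 - {0})) (\<lambda>(q, \<zeta>). \<alpha> q \<zeta>)"
    unfolding \<alpha>_def by (rule smooth_on_polar[OF \<alpha>p_smooth])
  have key: "D_std BE BD q \<zeta>h \<rho> = complex_of_real \<rho> * \<alpha>p q \<zeta>h \<rho> * D_mod BE BG q \<zeta>h \<rho>"
    if q: "q \<in> CB \<inter> Q" and \<zeta>h: "\<zeta>h \<in> freq_sphere dn" and \<rho>: "0 < \<rho>" "\<rho> \<le> \<rho>1" for q \<zeta>h \<rho>
  proof -
    obtain p s h where psh: "q = (p, s, h)" by (metis prod.collapse)
    obtain \<tau> \<gamma> \<eta> where \<zeta>: "\<zeta>h = (\<tau>, \<gamma>, \<eta>)" by (metis prod.collapse)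
    have qCB: "q \<in> CB" using q by simp
    obtain w1 w2 where w: "\<And>z. W z q \<in> Ustar"
      "\<And>z. ((\<lambda>z. W z q) has_vector_derivative w1 z) (at z)"
      "\<And>z. (w1 has_vector_derivative w2 z) (at z)"
      "\<And>z. (1 + (norm h)\<^sup>2) *\<^sub>R w2 z = calA A dn (W z q) s h *v w1 z"
      "\<And>\<sigma>. bounded (w1 ` half_line \<sigma>)" "w1 0 = \<omega> q"
      by (rule profile_derivatives[OF family manifold qCB psh, folded \<omega>_def], rule that)
    define v where "v = join (cvec (w1 0)) (cvec (w2 0))"
    let ?R = "\<lambda>\<sigma>. Rvec Rf \<sigma> q \<zeta>h \<rho>"
    have E: "v - complex_of_real \<rho> *s ?R \<sigma> \<in> E_side A dn W \<sigma> q \<zeta>h \<rho>" for \<sigma>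
      using profile_minus_corrector_in_E_side[where W = W, OF system corr w(1-5)[unfolded psh] qCB[unfolded psh] \<zeta>h \<rho>]
      unfolding v_def psh .
    have e: "join (v - complex_of_real \<rho> *s ?R Minus) (v - complex_of_real \<rho> *s ?R Plus) \<in> vec.span (range (BE q \<zeta>h \<rho>))"
      using basis_E[OF qCB \<zeta>h \<rho>] E unfolding orthonormal_basis_def E_prod_def by blast
    have "(\<Sum>i\<in>UNIV. l $ i * (v - complex_of_real \<rho> *s ?R Plus) $ i) = d q \<zeta>h \<rho>"
    proof -
      have b: "\<rho> *\<^sub>R (\<tau>, \<gamma>, \<eta>) \<in> freq_ball dn \<rho>1"
        using freq_ball_scaleR[OF \<zeta>h, of \<rho>] \<rho> by (simp add: \<zeta>)
      have R: "(complex_of_real \<rho> *s ?R Plus) $ Inl i = Rf Plus 0 q (\<rho> * \<tau>, \<rho> * \<gamma>, \<rho> *\<^sub>R \<eta>) $ i" for i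
        using \<rho>(1) by (simp add: Rvec_def join_def Rcheck_def \<zeta> scaleR_conv_of_real[where 'a = complex])
      have "(\<Sum>i\<in>UNIV. l $ i * (v - complex_of_real \<rho> *s ?R Plus) $ i) =
          (\<Sum>i\<in>UNIV. cvec ?wz $ i * (v - complex_of_real \<rho> *s ?R Plus) $ Inl i)"
        by (rule l_sum)
      also have "\<dots> = (\<Sum>i\<in>UNIV. cvec ?wz $ i * (cvec (\<omega> q) $ i - Rf Plus 0 q (\<rho> * \<tau>, \<rho> * \<gamma>, \<rho> *\<^sub>R \<eta>) $ i))"
        unfolding vector_minus_component R by (simp add: v_def join_def w(6))
      also have "\<dots> = complex_of_real (m q) -
          (\<Sum>i\<in>UNIV. cvec ?wz $ i * Rf Plus 0 q (\<rho> * \<tau>, \<rho> * \<gamma>, \<rho> *\<^sub>R \<eta>) $ i)"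
        by (simp add: right_diff_distrib sum_subtractf m_def inner_vec_def)
      also have "\<dots> = d q \<zeta>h \<rho>"
        using b by (subst norml[OF qCB])
          (simp_all add: d_def normal_component_def \<zeta> algebra_simps power_mult_distrib)
      finally show ?thesis .
    qed
    moreover have "D_std BE BD q \<zeta>h \<rho> * g q \<zeta>h \<rho> * (\<Sum>i\<in>UNIV. l $ i * (v - complex_of_real \<rho> *s ?R Plus) $ i) =
        complex_of_real \<rho> * c0 * D_mod BE BG q \<zeta>h \<rho>"
      unfolding D_std_def D_mod_def g_def c0_def
      by (rule det_pair_std_vs_mod[OF basis_D _ l' e])
        (use basis_G[OF qCB \<zeta>h, of \<rho>] \<rho> in \<open>simp add: G_mod_def l_def\<close>)
    ultimately have "D_std BE BD q \<zeta>h \<rho> * (g q \<zeta>h \<rho> * d q \<zeta>h \<rho>) = complex_of_real \<rho> * c0 * D_mod BE BG q \<zeta>h \<rho>"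
      by (simp add: mult.assoc)
    moreover have "g q \<zeta>h \<rho> * d q \<zeta>h \<rho> \<noteq> 0" using g[of q \<zeta>h \<rho>] d[OF q \<zeta>h] \<zeta>h qCB \<rho> by simp
    ultimately show ?thesis by (simp add: \<alpha>p_def field_simps)
  qed
  define T where "T = {q \<in> CB. strongly_transversal A dn pb wb k r \<Phi> zb asol q}"
  have TQ: "T \<inter> Q \<subseteq> CB \<inter> Q" by (auto simp: T_def)
  show ?thesis
    unfolding Let_def T_def[symmetric]
  proof (rule exI[of _ Q], intro conjI ballI)
    fix q0 assume q0: "q0 \<in> T \<inter> Q"
    show "\<exists>\<rho>0 V \<alpha> \<alpha>p c.
         0 < \<rho>0 \<and> \<rho>0 \<le> \<rho>1 \<and> open V \<and> q0 \<in> V \<and> 0 < c \<and>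
         smooth_on ((T \<inter> V) \<times> (freq_ball dn \<rho>0 - {0})) (\<lambda>(q, \<zeta>). \<alpha> q \<zeta> :: complex) \<and>
         smooth_on ((T \<inter> V) \<times> freq_sphere dn \<times> {0..\<rho>0}) (\<lambda>(q, \<zeta>h, \<rho>). \<alpha>p q \<zeta>h \<rho>) \<and>
         (\<forall>q \<in> T \<inter> V.
            (\<forall>\<zeta>h \<in> freq_sphere dn. \<forall>\<rho> \<in> {0<..\<rho>0}.
               \<alpha> q (\<rho> *\<^sub>R \<zeta>h) = \<alpha>p q \<zeta>h \<rho> \<and> c \<le> cmod (\<alpha> q (\<rho> *\<^sub>R \<zeta>h))) \<and>
            (\<exists>C. \<forall>\<zeta>h \<in> freq_sphere dn. \<forall>\<rho> \<in> {0<..\<rho>0}.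
               cmod (D_std BE BD q \<zeta>h \<rho> - complex_of_real \<rho> * \<alpha> q (\<rho> *\<^sub>R \<zeta>h) * D_mod BE BG q \<zeta>h \<rho>)
                 \<le> C * \<rho>\<^sup>2))"
    proof (rule exI[of _ \<rho>1], rule exI[of _ Q], rule exI[of _ \<alpha>], rule exI[of _ \<alpha>p], rule exI[of _ c],
        intro conjI ballI)
      show "smooth_on ((T \<inter> Q) \<times> (freq_ball dn \<rho>1 - {0})) (\<lambda>(q, \<zeta>). \<alpha> q \<zeta>)"
        by (rule smooth_on_subset[OF \<alpha>_smooth]) (use TQ in auto)
      show "smooth_on ((T \<inter> Q) \<times> freq_sphere dn \<times> {0..\<rho>1}) (\<lambda>(q, \<zeta>h, \<rho>). \<alpha>p q \<zeta>h \<rho>)"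
        by (rule smooth_on_subset[OF \<alpha>p_smooth]) (use TQ in auto)
    next
      fix q \<zeta>h \<rho> assume *: "q \<in> T \<inter> Q" "\<zeta>h \<in> freq_sphere dn" "\<rho> \<in> {0<..\<rho>1}"
      then show "\<alpha> q (\<rho> *\<^sub>R \<zeta>h) = \<alpha>p q \<zeta>h \<rho>" by (simp add: \<alpha>)
      show "c \<le> cmod (\<alpha> q (\<rho> *\<^sub>R \<zeta>h))" using * TQ c_le[of q \<zeta>h \<rho>] by (auto simp: \<alpha>)
    next
      fix q assume q: "q \<in> T \<inter> Q"
      show "\<exists>C. \<forall>\<zeta>h \<in> freq_sphere dn. \<forall>\<rho> \<in> {0<..\<rho>1}.
          cmod (D_std BE BD q \<zeta>h \<rho> - complex_of_real \<rho> * \<alpha> q (\<rho> *\<^sub>R \<zeta>h) * D_mod BE BG q \<zeta>h \<rho>) \<le> C * \<rho>\<^sup>2"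
        \<comment> \<open>The identity is exact, so the constant of the error term is \<open>0\<close>.\<close>
        by (rule exI[of _ 0]) (use q TQ in \<open>auto simp: \<alpha> key\<close>)
    qed (use \<rho>1 Q cpos q0 in auto)
  qed (use Q in auto)
qed

end
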